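(* Let $D_1\in\mathbb{R}^{n\times m_1}$ and $D_i\in\mathbb{R}^{m_{i-1}\times m_i}$ ($2\le i\le k$), and let $x=D_1\gamma_1$, $\gamma_{i-1}=D_i\gamma_i$ ($2\le i\le k$), where $\gamma_i\in\mathbb{R}^{m_i}$ has support $\Lambda_i$ of cardinality $s_i$. Let $y=x+e$ with $e\sim\mathcal{N}(0,\sigma^2 I)$. Assume the RIP constant of $D_{(k)}=D_1D_2\cdots D_k$ satisfies $\delta_{s_k}^{D_{(k)}}<1$. Let $r=\operatorname{rank}\{\Phi^{\Lambda_k}\}$ and let $\hat\gamma_1,\dots,\hat\gamma_k$ be the holistic oracle estimators. Then for every $1\le i\le k$, $$ \sigma^2 (s_k-r)\,\frac{\prod_{j=i+1}^{k}\left(\frac{s_{j-1}}{m_{j-1}}-\delta_{s_{j-1},s_j}^{D_j}\right)}{1+\delta_{s_k}^{D_{(k)}}} \;\le\;\mathbb{E}\,\|\gamma_i-\hat\gamma_i\|_2^2\;\le\; \sigma^2 (s_k-r)\,\frac{\prod_{j=i+1}^{k}\left(\frac{s_{j-1}}{m_{j-1}}+\delta_{s_{j-1},s_j}^{D_j}\right)}{1-\delta_{s_k}^{D_{(k)}}}. $$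
   Context: Notation. For a vector $v$ and index set $\Lambda$, $v^{\Lambda}$ is the restriction of $v$ to $\Lambda$, and $\Lambda^c$ is the complement of $\Lambda$. For a matrix $D$, $D^{\Lambda_c}$ is the submatrix of columns indexed by $\Lambda_c$, and $D^{\Lambda_r,\Lambda_c}$ is the submatrix with rows $\Lambda_r$ and columns $\Lambda_c$. $D_{(i,j)}=D_iD_{i+1}\cdots D_j$. $A^\dagger$ is the Moore–Penrose pseudo-inverse. Empty products equal $1$. RIP constant: $\delta_s^D$ is the smallest $\delta\ge 0$ such that $(1-\delta)\|v\|_2^2\le\|D^{\Lambda}v\|_2^2\le(1+\delta)\|v\|_2^2$ for every set $\Lambda$ of $s$ columns and every $v\in\mathbb{R}^s$. Subset RIP constant: for $D\in\mathbb{R}^{n\times m}$, $\delta_{s_R,s_C}^D$ is the minimum constant such that for every subset $\Lambda_R$ of $s_R$ rows, every subset $\Lambda_C$ of $s_C$ columns and all vectors $v\in\mathbb{R}^{s_C}$, $$\left(\tfrac{s_R}{n}-\delta_{s_R,s_C}^D\right)\|v\|_2^2\le\|D^{\Lambda_R,\Lambda_C}v\|_2^2\le\left(\tfrac{s_R}{n}+\delta_{s_R,s_C}^D\right)\|v\|_2^2 .$$ The matrix $\Phi^{\Lambda_k}$ is obtained by stacking vertically the blocks $D_{(2,k)}^{\Lambda_1^c,\Lambda_k},\ D_{(3,k)}^{\Lambda_2^c,\Lambda_k},\ \dots,\ D_{(k,k)}^{\Lambda_{k-1}^c,\Lambda_k}$. Holistic oracle estimators (the true supports $\Lambda_1,\dots,\Lambda_k$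 are known): let $K\in\mathbb{R}^{s_k\times(s_k-r)}$ be a matrix with orthonormal columns spanning $\ker\{\Phi^{\Lambda_k}\}$. Each $\hat\gamma_i\in\mathbb{R}^{m_i}$ vanishes outside $\Lambda_i$, with $$\hat\gamma_k^{\Lambda_k}=K\left(D_{(k)}^{\Lambda_k}K\right)^{\dagger}y$$ (the minimizer of $\|y-D_{(k)}^{\Lambda_k}v\|_2$ over $v\in\ker\{\Phi^{\Lambda_k}\}$), and $$\hat\gamma_i^{\Lambda_i}=D_{i+1}^{\Lambda_i,\Lambda_{i+1}}\hat\gamma_{i+1}^{\Lambda_{i+1}}\quad (i=k-1,\dots,1).$$ The expectation is over the noise $e$; $x$ and the $\gamma_i$ are fixed.
   Formalization: The lower bound is proved only when all factors s_{j-1}/m_{j-1} − δ^{D_j} (i<j≤k) are nonnegative or their product is at most 0; it can fail when an even number of negative factors makes the product positive. Also σ>0 is assumed. *)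

theory Defs
  imports
    "HOL-Probability.Probability"
    "Jordan_Normal_Form.DL_Rank"
    "Jordan_Normal_Form.DL_Submatrix"
    "Jordan_Normal_Form.Matrix_Kernel"
begin

(* The dimensions m_1, ..., m_k vary with the layer, so matrices and vectors are the
   carrier-based ones of Jordan_Normal_Form.  Rows, columns and entries are numbered from 0;
   the layers are numbered 1, ..., k. *)

definition sq_norm2 :: "real vec \<Rightarrow> real" where
  "sq_norm2 v = v \<bullet> v"

definition support_vec :: "real vec \<Rightarrow> nat set" where
  "support_vec v = {j. j < dim_vec v \<and> v $ j \<noteq> 0}"

(* Vector analogue of submatrix. *)
definition restrict_vec :: "real vec \<Rightarrow> nat set \<Rightarrow> real vec" where
  "restrict_vec v I = vec (card {j. j < dim_vec v \<and> j \<in> I}) (\<lambda>j. v $ pick I j)"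

definition rip_const :: "real mat \<Rightarrow> nat \<Rightarrow> real" where
  "rip_const D s = Inf {\<delta>. 0 \<le> \<delta> \<and>
     (\<forall>J. J \<subseteq> {..<dim_col D} \<and> card J = s \<longrightarrow>
       (\<forall>v \<in> carrier_vec s.
          (1 - \<delta>) * sq_norm2 v \<le> sq_norm2 (submatrix D UNIV J *\<^sub>v v) \<and>
          sq_norm2 (submatrix D UNIV J *\<^sub>v v) \<le> (1 + \<delta>) * sq_norm2 v))}"

(* Nonnegativity is not imposed: it follows from the two inequalities when 1 <= sC. *)
definition subset_rip_const :: "real mat \<Rightarrow> nat \<Rightarrow> nat \<Rightarrow> real" where
  "subset_rip_const D sR sC = Inf {\<delta>.
     \<forall>I J. I \<subseteq> {..<dim_row D} \<and> card I = sR \<and> J \<subseteq> {..<dim_col D} \<and> card J = sC \<longrightarrow>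
       (\<forall>v \<in> carrier_vec sC.
          (real sR / real (dim_row D) - \<delta>) * sq_norm2 v \<le> sq_norm2 (submatrix D I J *\<^sub>v v) \<and>
          sq_norm2 (submatrix D I J *\<^sub>v v) \<le> (real sR / real (dim_row D) + \<delta>) * sq_norm2 v)}"

(* The four Penrose conditions. *)
definition pseudo_inverse :: "real mat \<Rightarrow> real mat" where
  "pseudo_inverse A = (THE B. B \<in> carrier_mat (dim_col A) (dim_row A) \<and>
     A * B * A = A \<and> B * A * B = B \<and>
     transpose_mat (A * B) = A * B \<and> transpose_mat (B * A) = B * A)"

(* D_i D_(i+1) ... D_j, for i <= j only. *)
definition layer_prod :: "(nat \<Rightarrow> real mat) \<Rightarrow> nat \<Rightarrow> nat \<Rightarrow> real mat" where
  "layer_prod D i j = foldl (*) (D i) (map D [Suc i..<Suc j])"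

(* Column count is |Lambda_k|; for k = 1 there are no blocks and the matrix has no rows. *)
definition stacked_mat :: "(nat \<Rightarrow> real mat) \<Rightarrow> (nat \<Rightarrow> nat set) \<Rightarrow> nat \<Rightarrow> real mat" where
  "stacked_mat D \<Lambda> k = mat_of_rows (card (\<Lambda> k))
     (concat (map (\<lambda>l. rows (submatrix (layer_prod D l k) (- \<Lambda> (l - 1)) (\<Lambda> k))) [2..<Suc k]))"

definition orthonormal_cols :: "real mat \<Rightarrow> bool" where
  "orthonormal_cols K \<longleftrightarrow>
     (\<forall>a < dim_col K. \<forall>b < dim_col K. col K a \<bullet> col K b = (if a = b then 1 else 0))"

definition holistic_oracle_estimators ::
  "(nat \<Rightarrow> real mat) \<Rightarrow> (nat \<Rightarrow> nat) \<Rightarrow> (nat \<Rightarrow> nat set) \<Rightarrow> nat \<Rightarrow> real mat \<Rightarrow> real vec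
     \<Rightarrow> (nat \<Rightarrow> real vec) \<Rightarrow> bool" where
  "holistic_oracle_estimators D m \<Lambda> k K y est \<longleftrightarrow>
     (\<forall>i \<in> {1..k}. est i \<in> carrier_vec (m i) \<and> (\<forall>j < m i. j \<notin> \<Lambda> i \<longrightarrow> est i $ j = 0)) \<and>
     restrict_vec (est k) (\<Lambda> k) =
       K *\<^sub>v (pseudo_inverse (submatrix (layer_prod D 1 k) UNIV (\<Lambda> k) * K) *\<^sub>v y) \<and>
     (\<forall>i \<in> {1..<k}. restrict_vec (est i) (\<Lambda> i) =
       submatrix (D (i + 1)) (\<Lambda> i) (\<Lambda> (i + 1)) *\<^sub>v restrict_vec (est (i + 1)) (\<Lambda> (i + 1)))"

(* e ~ N(0, sigma^2 I_n): independent coordinates, each N(0, sigma^2); normal_density takes the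
   standard deviation, which must be positive. *)
definition white_gaussian_noise :: "'w measure \<Rightarrow> nat \<Rightarrow> real \<Rightarrow> ('w \<Rightarrow> real vec) \<Rightarrow> bool" where
  "white_gaussian_noise M n \<sigma> e \<longleftrightarrow>
     (\<forall>\<omega> \<in> space M. e \<omega> \<in> carrier_vec n) \<and>
     prob_space.indep_vars M (\<lambda>_. borel) (\<lambda>j \<omega>. e \<omega> $ j) {..<n} \<and>
     (\<forall>j < n. distributed M lborel (\<lambda>\<omega>. e \<omega> $ j) (normal_density 0 \<sigma>))"

end

theory Submission
  imports Defs
begin

text \<open>
  On \<open>\<Lambda>\<^sub>k\<close>, the vector \<open>\<gamma>\<^sub>k\<close> is \<open>K c\<close> for some \<open>c\<close>, since it lies in the kernel of the stacked
  matrix. With \<open>A\<close> the restriction of the dictionary product to \<open>\<Lambda>\<^sub>k\<close>, the matrix \<open>B = A K\<close> is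
  injective by the RIP assumption, so its pseudo-inverse \<open>P\<close> is a left inverse and the deepest error
  is the linear image \<open>K P e\<close> of the noise. Its mean squared norm is \<open>\<sigma>\<^sup>2\<close> times the squared
  Frobenius norm of \<open>P\<close>, whose \<open>s\<^sub>k - r\<close> rows have squared norm between \<open>1 / (1 + \<delta>)\<close> and
  \<open>1 / (1 - \<delta>)\<close>. The error at layer \<open>j - 1\<close> is the image of the error at layer \<open>j\<close> under the
  submatrix of \<open>D\<^sub>j\<close> on the two supports, and the subset RIP bounds this step pointwise.
\<close>

unbundle no vec_syntax
unbundle no inner_syntax

section \<open>Squared norms and their behaviour under matrices\<close>

lemma sq_norm2_sum: "sq_norm2 v = (\<Sum>j<dim_vec v. (v $ j)\<^sup>2)"
  by (simp add: sq_norm2_def scalar_prod_def power2_eq_square atLeast0LessThan)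

lemma sq_norm2_nonneg: "0 \<le> sq_norm2 v"
  by (simp add: sq_norm2_sum sum_nonneg)

lemma sq_norm2_zero: "sq_norm2 (0\<^sub>v q) = 0"
  by (simp add: sq_norm2_sum)

lemma sq_norm2_dim0: "v \<in> carrier_vec 0 \<Longrightarrow> sq_norm2 v = 0"
  by (auto simp: sq_norm2_sum)

lemma sq_norm2_eq_0_D:
  assumes "v \<in> carrier_vec q" "sq_norm2 v = 0"
  shows "v = 0\<^sub>v q"
proof (rule eq_vecI)
  fix j assume "j < dim_vec (0\<^sub>v q :: real vec)"
  then show "v $ j = 0\<^sub>v q $ j"
    using assms by (simp add: sq_norm2_sum sum_nonneg_eq_0_iff)
qed (use assms in simp)

lemma sq_norm2_minus_commute:
  "v \<in> carrier_vec q \<Longrightarrow> w \<in> carrier_vec q \<Longrightarrow> sq_norm2 (v - w) = sq_norm2 (w - v)"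
  by (auto simp: sq_norm2_sum power2_commute)

lemma sq_norm2_unit_vec: "a < q \<Longrightarrow> sq_norm2 (unit_vec q a) = 1"
  by (simp add: sq_norm2_def)

lemma scalar_prod_power2_le:
  assumes "v \<in> carrier_vec q" "w \<in> carrier_vec q"
  shows "(v \<bullet> w)\<^sup>2 \<le> sq_norm2 v * sq_norm2 w"
  using Cauchy_Schwarz_ineq_sum[of "\<lambda>j. v $ j" "\<lambda>j. w $ j" "{..<q}"] assms
  by (simp add: sq_norm2_sum scalar_prod_def atLeast0LessThan)

text \<open>Cauchy--Schwarz in each row; the witness is the squared Frobenius norm. A crude finite
  bound suffices: it is used to show that the sets defining the RIP constants are nonempty.\<close>

lemma sq_norm2_mult_mat_vec_bounded:
  "\<exists>C\<ge>0. \<forall>v \<in> carrier_vec (dim_col A). sq_norm2 (A *\<^sub>v v) \<le> C * sq_norm2 v"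
proof (intro exI conjI ballI)
  let ?C = "\<Sum>a<dim_row A. sq_norm2 (row A a)"
  show "0 \<le> ?C"
    by (simp add: sum_nonneg sq_norm2_nonneg)
  fix v :: "real vec" assume v: "v \<in> carrier_vec (dim_col A)"
  have "sq_norm2 (A *\<^sub>v v) = (\<Sum>a<dim_row A. (row A a \<bullet> v)\<^sup>2)"
    by (simp add: sq_norm2_sum)
  also have "\<dots> \<le> (\<Sum>a<dim_row A. sq_norm2 (row A a) * sq_norm2 v)"
    by (intro sum_mono scalar_prod_power2_le[OF _ v]) simp
  finally show "sq_norm2 (A *\<^sub>v v) \<le> ?C * sq_norm2 v"
    by (simp add: sum_distrib_right)
qed

lemma orthonormal_cols_gram:
  assumes "K \<in> carrier_mat q d" "orthonormal_cols K"
  shows "transpose_mat K * K = 1\<^sub>m d"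
  by (rule eq_matI) (use assms in \<open>auto simp: orthonormal_cols_def\<close>)

lemma sq_norm2_mult_mat_vec:
  assumes A: "A \<in> carrier_mat p d" and v: "v \<in> carrier_vec d"
  shows "sq_norm2 (A *\<^sub>v v) = v \<bullet> ((transpose_mat A * A) *\<^sub>v v)"
proof -
  have Av: "A *\<^sub>v v \<in> carrier_vec p" using A v by simp
  have "(transpose_mat A * A) *\<^sub>v v = transpose_mat A *\<^sub>v (A *\<^sub>v v)"
    by (rule assoc_mult_mat_vec[of _ d p _ d]) (use A v in auto)
  moreover have "(transpose_mat A *\<^sub>v (A *\<^sub>v v)) \<bullet> v = (A *\<^sub>v v) \<bullet> (A *\<^sub>v v)"
    by (rule transpose_vec_mult_scalar[OF A v Av])
  moreover have "(transpose_mat A *\<^sub>v (A *\<^sub>v v)) \<bullet> v = v \<bullet> (transpose_mat A *\<^sub>v (A *\<^sub>v v))"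
    by (rule comm_scalar_prod[of _ d]) (use A v in auto)
  ultimately show ?thesis by (simp add: sq_norm2_def)
qed

lemma sq_norm2_orthonormal_cols:
  assumes K: "K \<in> carrier_mat q d" "orthonormal_cols K" and v: "v \<in> carrier_vec d"
  shows "sq_norm2 (K *\<^sub>v v) = sq_norm2 v"
  using sq_norm2_mult_mat_vec[OF K(1) v] orthonormal_cols_gram[OF K] v by (simp add: sq_norm2_def)

section \<open>Restriction to index sets\<close>

text \<open>\<open>pick J\<close> enumerates \<open>J\<close> increasingly, so its inverse counts
  the smaller elements of \<open>J\<close>. The set \<open>J\<close> may be infinite, as it is for
  \<open>UNIV\<close> and for complements of supports.\<close>

lemma bij_betw_pick:
  "bij_betw (pick J) {..<card {j. j < q \<and> j \<in> J}} {j. j < q \<and> j \<in> J}"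
proof (rule bij_betwI)
  let ?S = "{j. j < q \<and> j \<in> J}"
  show "pick J \<in> {..<card ?S} \<rightarrow> ?S"
    using pick_in_set_le[of _ ?S] pick_reduce_set[of _ q J] by fastforce
  show "(\<lambda>j. card {a \<in> J. a < j}) \<in> ?S \<rightarrow> {..<card ?S}"
    by (auto intro!: psubset_card_mono)
  show "card {b \<in> J. b < pick J a} = a" if "a \<in> {..<card ?S}" for a
  proof -
    have "a < card J \<or> infinite J"
      using that card_mono[of J ?S] by fastforce
    then show ?thesis by (rule card_pick)
  qed
  show "pick J (card {a \<in> J. a < j}) = j" if "j \<in> ?S" for j
    using that by (simp add: pick_card_in_set)
qed

lemma sum_pick:
  fixes f :: "nat \<Rightarrow> 'a::comm_monoid_add"
  shows "(\<Sum>a<card {j. j < q \<and> j \<in> J}. f (pick J a)) = (\<Sum>j | j < q \<and> j \<in> J. f j)"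
  by (rule sum.reindex_bij_betw[OF bij_betw_pick])

lemma dim_restrict_vec: "dim_vec (restrict_vec v J) = card {j. j < dim_vec v \<and> j \<in> J}"
  by (simp add: restrict_vec_def)

lemma restrict_vec_carrier:
  assumes "v \<in> carrier_vec q" "J \<subseteq> {..<q}"
  shows "restrict_vec v J \<in> carrier_vec (card J)"
proof (rule carrier_vecI)
  have "{j. j < dim_vec v \<and> j \<in> J} = J" using assms by auto
  then show "dim_vec (restrict_vec v J) = card J"
    by (simp only: dim_restrict_vec)
qed

lemma sq_norm2_restrict_vec:
  assumes "v \<in> carrier_vec q" "\<And>j. j < q \<Longrightarrow> j \<notin> J \<Longrightarrow> v $ j = 0"
  shows "sq_norm2 (restrict_vec v J) = sq_norm2 v"
proof -
  have "sq_norm2 (restrict_vec v J) = (\<Sum>a<card {j. j < q \<and> j \<in> J}. (v $ pick J a)\<^sup>2)"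
    using assms by (simp add: sq_norm2_sum restrict_vec_def)
  also have "\<dots> = (\<Sum>j | j < q \<and> j \<in> J. (v $ j)\<^sup>2)"
    by (rule sum_pick)
  also have "\<dots> = (\<Sum>j<q. (v $ j)\<^sup>2)"
    by (rule sum.mono_neutral_left) (use assms in auto)
  finally show ?thesis using assms by (simp add: sq_norm2_sum)
qed

lemma restrict_vec_minus:
  assumes "v \<in> carrier_vec q" "w \<in> carrier_vec q"
  shows "restrict_vec (v - w) J = restrict_vec v J - restrict_vec w J"
proof (rule eq_vecI)
  fix a assume a: "a < dim_vec (restrict_vec v J - restrict_vec w J)"
  then have "pick J a < q"
    using assms pick_le by (auto simp: restrict_vec_def)
  then show "restrict_vec (v - w) J $ a = (restrict_vec v J - restrict_vec w J) $ a"
    using a assms by (auto simp: restrict_vec_def)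
qed (use assms in \<open>simp add: restrict_vec_def\<close>)

text \<open>Columns outside \<open>J\<close> only meet zero entries of \<open>v\<close>, so deleting
  them changes nothing. The row set stays free: it is later \<open>UNIV\<close> for the signal, a
  complement of a support for the kernel, and a support for the layer recursion.\<close>

lemma submatrix_mult_restrict_vec:
  assumes A: "A \<in> carrier_mat p q" and v: "v \<in> carrier_vec q"
    and supp: "\<And>j. j < q \<Longrightarrow> j \<notin> J \<Longrightarrow> v $ j = 0"
  shows "submatrix A I J *\<^sub>v restrict_vec v J = restrict_vec (A *\<^sub>v v) I"
proof (rule eq_vecI)
  fix a assume "a < dim_vec (restrict_vec (A *\<^sub>v v) I)"
  then have a: "a < card {b. b < p \<and> b \<in> I}"
    using A by (simp add: restrict_vec_def)
  then have pa: "pick I a < p"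
    by (rule pick_le)
  have "(submatrix A I J *\<^sub>v restrict_vec v J) $ a
      = (\<Sum>b<card {j. j < q \<and> j \<in> J}. A $$ (pick I a, pick J b) * v $ pick J b)"
    using A v a by (simp add: submatrix_def restrict_vec_def scalar_prod_def atLeast0LessThan)
  also have "\<dots> = (\<Sum>j | j < q \<and> j \<in> J. A $$ (pick I a, j) * v $ j)"
    by (rule sum_pick)
  also have "\<dots> = (\<Sum>j<q. A $$ (pick I a, j) * v $ j)"
    by (rule sum.mono_neutral_left) (use supp in auto)
  also have "\<dots> = restrict_vec (A *\<^sub>v v) I $ a"
    using A v a pa by (simp add: restrict_vec_def scalar_prod_def atLeast0LessThan)
  finally show "(submatrix A I J *\<^sub>v restrict_vec v J) $ a = restrict_vec (A *\<^sub>v v) I $ a" .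
qed (use A in \<open>simp add: restrict_vec_def submatrix_def\<close>)

section \<open>Restricted isometry constants as infima\<close>

text \<open>For \<open>t > 0\<close> the quotient \<open>c / t\<close> is a lower bound of
  \<open>S\<close>; for \<open>t = 0\<close> any single element of \<open>S\<close> gives
  \<open>c \<le> 0\<close>. This transfers the RIP inequalities from the admissible constants to
  their infimum.\<close>

lemma le_Inf_mult:
  fixes c t :: real
  assumes "S \<noteq> {}" "0 \<le> t" "\<And>\<delta>. \<delta> \<in> S \<Longrightarrow> c \<le> \<delta> * t"
  shows "c \<le> Inf S * t"
proof (cases "t = 0")
  case True
  then show ?thesis using assms by auto
next
  case False
  then have "c / t \<le> Inf S"
    using assms by (intro cInf_greatest) (auto simp: divide_le_eq)
  then show ?thesis using False assms by (simp add: divide_le_eq)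
qed

lemma submatrix_carrier:
  assumes "A \<in> carrier_mat p q" "I \<subseteq> {..<p}" "J \<subseteq> {..<q}"
  shows "submatrix A I J \<in> carrier_mat (card I) (card J)"
proof (rule carrier_matI)
  have "{j. j < dim_row A \<and> j \<in> I} = I" "{j. j < dim_col A \<and> j \<in> J} = J"
    using assms by auto
  then show "dim_row (submatrix A I J) = card I" "dim_col (submatrix A I J) = card J"
    by (simp_all only: dim_submatrix)
qed

lemma submatrix_UNIV_carrier:
  assumes "A \<in> carrier_mat p q" "J \<subseteq> {..<q}"
  shows "submatrix A UNIV J \<in> carrier_mat p (card J)"
proof (rule carrier_matI)
  have "{j. j < dim_col A \<and> j \<in> J} = J"
    using assms by auto
  then show "dim_col (submatrix A UNIV J) = card J"
    by (simp only: dim_submatrix)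
  show "dim_row (submatrix A UNIV J) = p"
    using assms by (simp add: dim_submatrix)
qed

text \<open>There are finitely many index pairs, so the sum of the individual bounds dominates each
  of them. The family \<open>F\<close> is abstract in order to cover both column submatrices and
  submatrices on rows and columns.\<close>

lemma submatrices_bounded:
  fixes F :: "nat set \<Rightarrow> nat set \<Rightarrow> real mat"
  shows "\<exists>C\<ge>0. \<forall>I J. I \<subseteq> {..<p} \<longrightarrow> J \<subseteq> {..<q} \<longrightarrow>
     (\<forall>v\<in>carrier_vec (dim_col (F I J)). sq_norm2 (F I J *\<^sub>v v) \<le> C * sq_norm2 v)"
proof -
  obtain C where C: "\<And>I J. (0::real) \<le> C I J"
    "\<And>I J v. v \<in> carrier_vec (dim_col (F I J)) \<Longrightarrow> sq_norm2 (F I J *\<^sub>v v) \<le> C I J * sq_norm2 v"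
    using sq_norm2_mult_mat_vec_bounded[of "F _ _"] by metis
  define T where "T = (\<Sum>(I, J) \<in> Pow {..<p} \<times> Pow {..<q}. C I J)"
  have "C I J \<le> T" if "I \<subseteq> {..<p}" "J \<subseteq> {..<q}" for I J
  proof -
    have "(case (I, J) of (I, J) \<Rightarrow> C I J) \<le> T"
      unfolding T_def by (rule member_le_sum) (use that C(1) in \<open>auto simp: finite_SigmaI\<close>)
    then show ?thesis by simp
  qed
  moreover have "0 \<le> T"
    unfolding T_def using C(1) by (intro sum_nonneg) auto
  ultimately show ?thesis
    by (intro exI[of _ T]) (meson C(2) mult_right_mono order_trans sq_norm2_nonneg)
qed

lemma rip_const_set_nonempty:
  assumes D: "D \<in> carrier_mat p q"
  shows "{\<delta>. 0 \<le> \<delta> \<and>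
     (\<forall>J. J \<subseteq> {..<dim_col D} \<and> card J = s \<longrightarrow>
       (\<forall>v \<in> carrier_vec s.
          (1 - \<delta>) * sq_norm2 v \<le> sq_norm2 (submatrix D UNIV J *\<^sub>v v) \<and>
          sq_norm2 (submatrix D UNIV J *\<^sub>v v) \<le> (1 + \<delta>) * sq_norm2 v))} \<noteq> {}"
proof -
  obtain C where C: "0 \<le> C" "\<forall>I J. I \<subseteq> {..<p} \<longrightarrow> J \<subseteq> {..<q} \<longrightarrow>
     (\<forall>v\<in>carrier_vec (dim_col (submatrix D UNIV J)).
        sq_norm2 (submatrix D UNIV J *\<^sub>v v) \<le> C * sq_norm2 v)"
    using submatrices_bounded[of p q "\<lambda>I J. submatrix D UNIV J"] by auto
  \<comment> \<open>The admissible constant is \<open>1 + C\<close>: the lower factor becomes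
    \<open>- C \<le> 0\<close>, and the upper factor \<open>2 + C\<close> exceeds
    \<open>C\<close>.\<close>
  have "(1 - (1 + C)) * sq_norm2 v \<le> sq_norm2 (submatrix D UNIV J *\<^sub>v v) \<and>
        sq_norm2 (submatrix D UNIV J *\<^sub>v v) \<le> (1 + (1 + C)) * sq_norm2 v"
    if "J \<subseteq> {..<q}" "card J = s" "v \<in> carrier_vec s" for J v
  proof
    have "v \<in> carrier_vec (dim_col (submatrix D UNIV J))"
      using submatrix_UNIV_carrier[OF D that(1)] that by auto
    then have "sq_norm2 (submatrix D UNIV J *\<^sub>v v) \<le> C * sq_norm2 v"
      using C(2) that by blast
    then show "sq_norm2 (submatrix D UNIV J *\<^sub>v v) \<le> (1 + (1 + C)) * sq_norm2 v"
      using sq_norm2_nonneg[of v] by (simp add: algebra_simps)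
    show "(1 - (1 + C)) * sq_norm2 v \<le> sq_norm2 (submatrix D UNIV J *\<^sub>v v)"
      using mult_nonneg_nonneg[OF C(1) sq_norm2_nonneg[of v]]
        sq_norm2_nonneg[of "submatrix D UNIV J *\<^sub>v v"] by simp
  qed
  then have "1 + C \<in> {\<delta>. 0 \<le> \<delta> \<and>
     (\<forall>J. J \<subseteq> {..<dim_col D} \<and> card J = s \<longrightarrow>
       (\<forall>v \<in> carrier_vec s.
          (1 - \<delta>) * sq_norm2 v \<le> sq_norm2 (submatrix D UNIV J *\<^sub>v v) \<and>
          sq_norm2 (submatrix D UNIV J *\<^sub>v v) \<le> (1 + \<delta>) * sq_norm2 v))}"
    using D C(1) by simp
  then show ?thesis by blast
qed

lemma rip_const_nonneg:
  assumes "D \<in> carrier_mat p q"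
  shows "0 \<le> rip_const D s"
  unfolding rip_const_def
  by (rule cInf_greatest[OF rip_const_set_nonempty[OF assms]]) simp

lemma rip_const_bounds:
  assumes D: "D \<in> carrier_mat p q" and J: "J \<subseteq> {..<q}" and v: "v \<in> carrier_vec (card J)"
  shows "(1 - rip_const D (card J)) * sq_norm2 v \<le> sq_norm2 (submatrix D UNIV J *\<^sub>v v)"
    and "sq_norm2 (submatrix D UNIV J *\<^sub>v v) \<le> (1 + rip_const D (card J)) * sq_norm2 v"
proof -
  note ne = rip_const_set_nonempty[OF D, of "card J"]
  \<comment> \<open>Isolating the term with \<delta> puts the inequality into the form required by
    \<open>le_Inf_mult\<close>.\<close>
  have "sq_norm2 v - sq_norm2 (submatrix D UNIV J *\<^sub>v v) \<le> rip_const D (card J) * sq_norm2 v"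
    unfolding rip_const_def
    by (rule le_Inf_mult[OF ne sq_norm2_nonneg]) (use D J v in \<open>auto simp: algebra_simps\<close>)
  then show "(1 - rip_const D (card J)) * sq_norm2 v \<le> sq_norm2 (submatrix D UNIV J *\<^sub>v v)"
    by (simp add: algebra_simps)
  have "sq_norm2 (submatrix D UNIV J *\<^sub>v v) - sq_norm2 v \<le> rip_const D (card J) * sq_norm2 v"
    unfolding rip_const_def
    by (rule le_Inf_mult[OF ne sq_norm2_nonneg]) (use D J v in \<open>auto simp: algebra_simps\<close>)
  then show "sq_norm2 (submatrix D UNIV J *\<^sub>v v) \<le> (1 + rip_const D (card J)) * sq_norm2 v"
    by (simp add: algebra_simps)
qed

lemma subset_rip_const_set_nonempty:
  assumes D: "D \<in> carrier_mat p q"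
  shows "{\<delta>.
     \<forall>I J. I \<subseteq> {..<dim_row D} \<and> card I = sR \<and> J \<subseteq> {..<dim_col D} \<and> card J = sC \<longrightarrow>
       (\<forall>v \<in> carrier_vec sC.
          (real sR / real (dim_row D) - \<delta>) * sq_norm2 v \<le> sq_norm2 (submatrix D I J *\<^sub>v v) \<and>
          sq_norm2 (submatrix D I J *\<^sub>v v) \<le> (real sR / real (dim_row D) + \<delta>) * sq_norm2 v)} \<noteq> {}"
proof -
  obtain C where C: "0 \<le> C" "\<forall>I J. I \<subseteq> {..<p} \<longrightarrow> J \<subseteq> {..<q} \<longrightarrow>
     (\<forall>v\<in>carrier_vec (dim_col (submatrix D I J)).
        sq_norm2 (submatrix D I J *\<^sub>v v) \<le> C * sq_norm2 v)"
    using submatrices_bounded[of p q "\<lambda>I J. submatrix D I J"] by auto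
  \<comment> \<open>The admissible constant is \<open>c + C\<close>, by the same reasoning with
    \<open>c\<close> in place of 1.\<close>
  define c where "c = real sR / real p"
  have c0: "0 \<le> c" by (simp add: c_def)
  have "(c - (c + C)) * sq_norm2 v \<le> sq_norm2 (submatrix D I J *\<^sub>v v) \<and>
        sq_norm2 (submatrix D I J *\<^sub>v v) \<le> (c + (c + C)) * sq_norm2 v"
    if "I \<subseteq> {..<p}" "J \<subseteq> {..<q}" "card J = sC" "v \<in> carrier_vec sC" for I J v
  proof
    have "v \<in> carrier_vec (dim_col (submatrix D I J))"
      using submatrix_carrier[OF D that(1,2)] that by auto
    then have "sq_norm2 (submatrix D I J *\<^sub>v v) \<le> C * sq_norm2 v"
      using C(2) that by blast
    then show "sq_norm2 (submatrix D I J *\<^sub>v v) \<le> (c + (c + C)) * sq_norm2 v"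
      using mult_nonneg_nonneg[OF c0 sq_norm2_nonneg[of v]] by (simp add: algebra_simps)
    show "(c - (c + C)) * sq_norm2 v \<le> sq_norm2 (submatrix D I J *\<^sub>v v)"
      using mult_nonneg_nonneg[OF C(1) sq_norm2_nonneg[of v]]
        sq_norm2_nonneg[of "submatrix D I J *\<^sub>v v"] by simp
  qed
  then show ?thesis
    using D unfolding c_def by (intro ex_in_conv[THEN iffD1] exI[of _ "real sR / real p + C"]) simp
qed

text \<open>If \<open>J\<close> is empty, every real number is admissible and the infimum is
  unspecified; the inequalities survive because it is then multiplied by
  \<open>sq_norm2 v = 0\<close>.\<close>

lemma subset_rip_const_bounds:
  assumes D: "D \<in> carrier_mat p q" and I: "I \<subseteq> {..<p}" and J: "J \<subseteq> {..<q}"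
    and v: "v \<in> carrier_vec (card J)"
  shows "(real (card I) / real p - subset_rip_const D (card I) (card J)) * sq_norm2 v
      \<le> sq_norm2 (submatrix D I J *\<^sub>v v)"
    and "sq_norm2 (submatrix D I J *\<^sub>v v)
      \<le> (real (card I) / real p + subset_rip_const D (card I) (card J)) * sq_norm2 v"
proof -
  note ne = subset_rip_const_set_nonempty[OF D, of "card I" "card J"]
  have "real (card I) / real p * sq_norm2 v - sq_norm2 (submatrix D I J *\<^sub>v v)
      \<le> subset_rip_const D (card I) (card J) * sq_norm2 v"
    unfolding subset_rip_const_def
    by (rule le_Inf_mult[OF ne sq_norm2_nonneg]) (use D I J v in \<open>auto simp: algebra_simps\<close>)
  then show "(real (card I) / real p - subset_rip_const D (card I) (card J)) * sq_norm2 v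
      \<le> sq_norm2 (submatrix D I J *\<^sub>v v)"
    by (simp add: algebra_simps)
  have "sq_norm2 (submatrix D I J *\<^sub>v v) - real (card I) / real p * sq_norm2 v
      \<le> subset_rip_const D (card I) (card J) * sq_norm2 v"
    unfolding subset_rip_const_def
    by (rule le_Inf_mult[OF ne sq_norm2_nonneg]) (use D I J v in \<open>auto simp: algebra_simps\<close>)
  then show "sq_norm2 (submatrix D I J *\<^sub>v v)
      \<le> (real (card I) / real p + subset_rip_const D (card I) (card J)) * sq_norm2 v"
    by (simp add: algebra_simps)
qed

text \<open>Without rows every image has norm 0, so the admissible constants are exactly the
  nonnegative ones. This makes the factors of both bounds vanish at a layer with empty support below
  a nonempty one.\<close>

lemma subset_rip_const_no_rows:
  assumes D: "D \<in> carrier_mat p q" and sC: "0 < sC" "sC \<le> q"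
  shows "subset_rip_const D 0 sC = 0"
proof -
  have main: "(\<forall>I J. I \<subseteq> {..<p} \<and> card I = 0 \<and> J \<subseteq> {..<q} \<and> card J = sC \<longrightarrow>
       (\<forall>v \<in> carrier_vec sC.
          (real 0 / real p - \<delta>) * sq_norm2 v \<le> sq_norm2 (submatrix D I J *\<^sub>v v) \<and>
          sq_norm2 (submatrix D I J *\<^sub>v v) \<le> (real 0 / real p + \<delta>) * sq_norm2 v)) \<longleftrightarrow> 0 \<le> \<delta>"
    (is "?L \<delta> \<longleftrightarrow> _") for \<delta>
  proof
    assume "?L \<delta>"
    \<comment> \<open>A unit vector on some column set detects the sign of \<delta>; here
      \<open>sC \<le> q\<close> provides the columns and \<open>0 < sC\<close> the unit
      vector.\<close>
    from this[rule_format, of "{}" "{..<sC}" "unit_vec sC 0"]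
    have "sq_norm2 (submatrix D {} {..<sC} *\<^sub>v unit_vec sC 0) \<le> \<delta>"
      using sC by (simp add: sq_norm2_unit_vec)
    then show "0 \<le> \<delta>"
      by (rule order_trans[OF sq_norm2_nonneg])
  next
    assume \<delta>: "0 \<le> \<delta>"
    show "?L \<delta>"
    proof (intro allI impI ballI)
      fix I J and v :: "real vec"
      assume IJ: "I \<subseteq> {..<p} \<and> card I = 0 \<and> J \<subseteq> {..<q} \<and> card J = sC"
      then have "finite I"
        using finite_subset[of I "{..<p}"] by blast
      then have "I = {}"
        using IJ card_0_eq by blast
      have "dim_vec (submatrix D {} J *\<^sub>v v) = 0"
        by (simp add: submatrix_def)
      then have "sq_norm2 (submatrix D {} J *\<^sub>v v) = 0"
        by (simp add: sq_norm2_sum)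
      with \<open>I = {}\<close> show "(real 0 / real p - \<delta>) * sq_norm2 v \<le> sq_norm2 (submatrix D I J *\<^sub>v v) \<and>
          sq_norm2 (submatrix D I J *\<^sub>v v) \<le> (real 0 / real p + \<delta>) * sq_norm2 v"
        using \<delta> sq_norm2_nonneg[of v] by simp
    qed
  qed
  have "subset_rip_const D 0 sC = Inf {\<delta>. ?L \<delta>}"
    using D by (simp only: subset_rip_const_def carrier_matD)
  also have "{\<delta>. ?L \<delta>} = {0..}"
    unfolding main by auto
  also have "Inf {0..} = (0 :: real)"
    by (rule cInf_atLeast)
  finally show ?thesis .
qed

section \<open>Pseudo-inverse of an injective matrix\<close>

text \<open>A vector \<open>v\<close> in the kernel of the Gram matrix satisfies
  \<open>sq_norm2 (B *\<^sub>v v) = 0\<close>, hence vanishes by injectivity; the determinant is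
  therefore nonzero.\<close>

lemma injective_left_inverse_gram:
  fixes B :: "real mat"
  assumes B: "B \<in> carrier_mat p d"
    and inj: "\<And>v. v \<in> carrier_vec d \<Longrightarrow> B *\<^sub>v v = 0\<^sub>v p \<Longrightarrow> v = 0\<^sub>v d"
  obtains G where "G \<in> carrier_mat d d" "G * (transpose_mat B * B) = 1\<^sub>m d"
    "(transpose_mat B * B) * G = 1\<^sub>m d"
proof -
  let ?G = "transpose_mat B * B"
  have GC: "?G \<in> carrier_mat d d" using B by simp
  have "det ?G \<noteq> 0"
  proof
    assume "det ?G = 0"
    then obtain v where v: "v \<in> carrier_vec d" "v \<noteq> 0\<^sub>v d" "?G *\<^sub>v v = 0\<^sub>v d"
      using det_0_iff_vec_prod_zero[OF GC] by blast
    have "sq_norm2 (B *\<^sub>v v) = 0"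
      using sq_norm2_mult_mat_vec[OF B v(1)] v by simp
    then have "B *\<^sub>v v = 0\<^sub>v p"
      using B v by (intro sq_norm2_eq_0_D) auto
    then show False using inj v by blast
  qed
  from det_non_zero_imp_unit[OF GC this, of "()"] that show ?thesis
    unfolding Units_def ring_mat_def by auto
qed

text \<open>The definite description in \<open>pseudo_inverse\<close> is resolved by the explicit
  matrix \<open>X = G B^T\<close>, with \<open>G\<close> the inverse of the Gram matrix. Existence
  and uniqueness under the Penrose conditions are both proved here.\<close>

lemma pseudo_inverse_injective:
  fixes B :: "real mat"
  assumes B: "B \<in> carrier_mat p d"
    and inj: "\<And>v. v \<in> carrier_vec d \<Longrightarrow> B *\<^sub>v v = 0\<^sub>v p \<Longrightarrow> v = 0\<^sub>v d"
  shows "pseudo_inverse B \<in> carrier_mat d p"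
    and "pseudo_inverse B * B = 1\<^sub>m d"
    and "transpose_mat (B * pseudo_inverse B) = B * pseudo_inverse B"
proof -
  obtain G where G: "G \<in> carrier_mat d d" "G * (transpose_mat B * B) = 1\<^sub>m d"
      "(transpose_mat B * B) * G = 1\<^sub>m d"
    using injective_left_inverse_gram[OF B inj] by blast
  define X where "X = G * transpose_mat B"
  have X: "X \<in> carrier_mat d p"
    using B G by (simp add: X_def)
  have XB: "X * B = 1\<^sub>m d"
    unfolding X_def using B G by (subst assoc_mult_mat[of _ d d _ p _ d]) auto
  define N where "N = transpose_mat B * B"
  have N: "N \<in> carrier_mat d d" and NT: "transpose_mat N = N"
    using B by (simp_all add: N_def transpose_mult[of _ d p _ d])
  have NG: "N * G = 1\<^sub>m d"
    using G(3) by (simp add: N_def)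
  \<comment> \<open>\<open>N\<close> is symmetric, so the transpose of its right inverse
    \<open>G\<close> is a left inverse and must coincide with \<open>G\<close>.\<close>
  have "transpose_mat G * N = transpose_mat (N * G)"
    by (simp add: transpose_mult[OF N G(1)] NT)
  then have GTN: "transpose_mat G * N = 1\<^sub>m d"
    by (simp add: NG)
  have "transpose_mat G = transpose_mat G * (N * G)"
    using G(1) by (simp add: NG)
  also have "\<dots> = (transpose_mat G * N) * G"
    using N G(1) by simp
  finally have GT: "transpose_mat G = G"
    using G(1) by (simp add: GTN)
  have BX_sym: "transpose_mat (B * X) = B * X"
  proof -
    have "transpose_mat (B * X) = transpose_mat X * transpose_mat B"
      using transpose_mult[OF B X] .
    also have "transpose_mat X = B * G"
      unfolding X_def using B G by (simp add: transpose_mult[of _ d d _ p] GT)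
    finally show ?thesis
      unfolding X_def using B G by (subst (asm) assoc_mult_mat[of _ p d _ d _ p]) auto
  qed
  let ?P = "\<lambda>Z. Z \<in> carrier_mat (dim_col B) (dim_row B) \<and>
     B * Z * B = B \<and> Z * B * Z = Z \<and>
     transpose_mat (B * Z) = B * Z \<and> transpose_mat (Z * B) = Z * B"
  have "pseudo_inverse B = X"
    unfolding pseudo_inverse_def
  proof (rule the_equality)
    have "B * X * B = B"
      using B X XB by (subst assoc_mult_mat[of _ p d _ p _ d]) auto
    then show "?P X"
      using B X XB BX_sym by simp
  next
    fix Z assume Z': "?P Z"
    then have Z: "Z \<in> carrier_mat d p" and BZB: "B * Z * B = B" and ZBZ: "Z * B * Z = Z"
      and BZ_sym: "transpose_mat (B * Z) = B * Z"
      using B by auto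
    \<comment> \<open>Cancelling \<open>B\<close> on the left by means of \<open>X\<close> shows
      that any competitor \<open>Z\<close> is a left inverse too.\<close>
    have "X * (B * Z * B) = X * B"
      using BZB by simp
    moreover have "X * (B * Z * B) = (X * B) * (Z * B)"
      using B X Z by (simp add: assoc_mult_mat[of X d p B d "Z * B" d])
    ultimately have ZB: "Z * B = 1\<^sub>m d"
      using XB B Z by simp
    \<comment> \<open>Inserting \<open>X B = 1\<close> gives \<open>B Z = (B X) (B Z)\<close>. Both
      factors are symmetric, so transposing swaps them, and \<open>Z B = 1\<close> collapses the
      result to \<open>B X\<close>.\<close>
    have "B * Z = B * (X * B) * Z"
      using B Z by (simp add: XB)
    also have "\<dots> = (B * X) * (B * Z)"
      using B X Z by (simp add: assoc_mult_mat[of B p d "X * B" d Z p]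
          assoc_mult_mat[of X d p B d Z p] assoc_mult_mat[of B p d X p "B * Z" p])
    finally have "transpose_mat (B * Z) = transpose_mat ((B * X) * (B * Z))"
      by simp
    also have "\<dots> = transpose_mat (B * Z) * transpose_mat (B * X)"
      by (rule transpose_mult[of _ p p _ p]) (use B X Z in simp_all)
    finally have "B * Z = (B * Z) * (B * X)"
      by (simp only: BZ_sym BX_sym)
    also have "\<dots> = B * (Z * B) * X"
      using B X Z by (simp add: assoc_mult_mat[of B p d "Z * B" d X p]
          assoc_mult_mat[of Z d p B d X p] assoc_mult_mat[of B p d Z p "B * X" p])
    finally have BZ: "B * Z = B * X"
      using B X by (simp add: ZB)
    have "Z = (X * B) * Z"
      using Z by (simp add: XB)
    also have "\<dots> = X * (B * Z)"
      using B X Z by simp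
    also have "\<dots> = (X * B) * X"
      using B X by (simp add: BZ)
    also have "\<dots> = X"
      using X by (simp add: XB)
    finally show "Z = X" .
  qed
  then show "pseudo_inverse B \<in> carrier_mat d p" "pseudo_inverse B * B = 1\<^sub>m d"
    "transpose_mat (B * pseudo_inverse B) = B * pseudo_inverse B"
    using X XB BX_sym by simp_all
qed

text \<open>Row \<open>a\<close> of the pseudo-inverse \<open>P\<close> is \<open>B w\<close> with \<open>w = P P\<^sup>T e\<^sub>a\<close>, so its squared norm \<open>t\<close>
  is the entry \<open>w\<^sub>a\<close>; the lower norm bound on \<open>B\<close> then gives \<open>t \<ge> c t\<^sup>2\<close>. Moreover
  \<open>1 = \<langle>B e\<^sub>a, p\<^sub>a\<rangle>\<close>, and Cauchy--Schwarz gives the other direction.\<close>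

lemma pseudo_inverse_row_bounds:
  fixes B :: "real mat"
  assumes B: "B \<in> carrier_mat p d" and c: "0 < c"
    and lower: "\<And>v. v \<in> carrier_vec d \<Longrightarrow> c * sq_norm2 v \<le> sq_norm2 (B *\<^sub>v v)"
    and upper: "\<And>v. v \<in> carrier_vec d \<Longrightarrow> sq_norm2 (B *\<^sub>v v) \<le> C * sq_norm2 v"
    and a: "a < d"
  shows "1 / C \<le> sq_norm2 (row (pseudo_inverse B) a)"
    and "sq_norm2 (row (pseudo_inverse B) a) \<le> 1 / c"
proof -
  have inj: "v = 0\<^sub>v d" if "v \<in> carrier_vec d" "B *\<^sub>v v = 0\<^sub>v p" for v
  proof (rule sq_norm2_eq_0_D[OF that(1)])
    have "c * sq_norm2 v \<le> 0"
      using lower[OF that(1)] that(2) by (simp add: sq_norm2_zero)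
    then show "sq_norm2 v = 0"
      using c sq_norm2_nonneg[of v] by (simp add: mult_le_0_iff)
  qed
  define P where "P = pseudo_inverse B"
  have P: "P \<in> carrier_mat d p" and PB: "P * B = 1\<^sub>m d" and sym: "transpose_mat (B * P) = B * P"
    unfolding P_def using pseudo_inverse_injective[OF B inj] by auto
  define pa where "pa = row P a"
  have pa: "pa \<in> carrier_vec p" using P a by (simp add: pa_def carrier_vecI)
  define t where "t = sq_norm2 pa"
  have one: "pa \<bullet> col B a = 1"
  proof -
    have "(P * B) $$ (a, a) = pa \<bullet> col B a"
      using B P a by (simp add: pa_def)
    then show ?thesis using a by (simp add: PB)
  qed
  have "1 \<le> t * sq_norm2 (col B a)"
    using scalar_prod_power2_le[OF pa, of "col B a"] one B a by (simp add: t_def carrier_vecI)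
  moreover have colB: "sq_norm2 (col B a) \<le> C"
    using upper[of "unit_vec d a"] col_mult2[OF B one_carrier_mat a] B a
    by (simp add: sq_norm2_unit_vec)
  moreover have "0 \<le> t" by (simp add: t_def sq_norm2_nonneg)
  ultimately have tC: "1 \<le> t * C"
    using mult_left_mono order_trans by blast
  have "0 < sq_norm2 (col B a)"
    using \<open>1 \<le> t * sq_norm2 (col B a)\<close> sq_norm2_nonneg[of "col B a"] by (cases "sq_norm2 (col B a) = 0") auto
  then have "0 < C" using colB by simp
  then show "1 / C \<le> sq_norm2 (row (pseudo_inverse B) a)"
    using tC by (simp add: t_def pa_def P_def divide_le_eq)
  define w where "w = P *\<^sub>v pa"
  have w: "w \<in> carrier_vec d" using P pa by (simp add: w_def)
  have wa: "w $ a = t"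
    using P a by (simp add: w_def t_def pa_def sq_norm2_def)
  have "B *\<^sub>v w = (B * P) *\<^sub>v col (transpose_mat P) a"
    unfolding w_def pa_def using B P a by simp
  also have "\<dots> = col ((B * P) * transpose_mat P) a"
    by (rule col_mult2[of _ p p _ d, symmetric]) (use B P a in simp_all)
  \<comment> \<open>The projection \<open>B P\<close> fixes the rows of \<open>P\<close>: by
    symmetry the left-hand side is the transpose of \<open>P B P\<close>, which equals
    \<open>P\<close>.\<close>
  also have "(B * P) * transpose_mat P = transpose_mat P"
  proof -
    have "(B * P) * transpose_mat P = transpose_mat (B * P) * transpose_mat P"
      by (simp add: sym)
    also have "\<dots> = transpose_mat (P * (B * P))"
      using B P by (simp add: transpose_mult[of P d p "B * P" p])
    also have "P * (B * P) = (P * B) * P"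
      using B P by simp
    finally show ?thesis using PB P by simp
  qed
  finally have "B *\<^sub>v w = pa"
    using P a by (simp add: pa_def)
  then have "c * sq_norm2 w \<le> t"
    using lower[OF w] by (simp add: t_def)
  moreover have "t\<^sup>2 \<le> sq_norm2 w"
    using w a wa member_le_sum[of a "{..<d}" "\<lambda>j. (w $ j)\<^sup>2"] by (simp add: sq_norm2_sum)
  ultimately have "c * t\<^sup>2 \<le> t"
    using c mult_left_mono[of "t\<^sup>2" "sq_norm2 w" c] by linarith
  then have "c * t \<le> 1"
    using \<open>0 \<le> t\<close> by (cases "t = 0") (auto simp: power2_eq_square)
  then show "sq_norm2 (row (pseudo_inverse B) a) \<le> 1 / c"
    using c by (simp add: t_def pa_def P_def field_simps)
qed

section \<open>Propagation of bounds through the layers\<close>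

text \<open>The constants \<open>L j\<close> and \<open>U j\<close> are unconstrained when \<open>s j = 0\<close>, because the subset RIP constant
  is then the infimum of the whole real line, an unspecified value. This is harmless: if \<open>s k > 0\<close>,
  the largest \<open>j\<close> with \<open>s j = 0\<close> makes the factor with index \<open>j + 1\<close> vanish.\<close>

lemma chain_bounds:
  fixes a L U :: "nat \<Rightarrow> real" and s :: "nat \<Rightarrow> nat"
  assumes step: "\<And>j. j \<in> {Suc i..k} \<Longrightarrow> 0 < s j \<Longrightarrow>
      L j * a j \<le> a (j - 1) \<and> a (j - 1) \<le> U j * a j \<and> 0 \<le> U j"
    and no_rows: "\<And>j. j \<in> {Suc i..k} \<Longrightarrow> 0 < s j \<Longrightarrow> s (j - 1) = 0 \<Longrightarrow> L j = 0 \<and> U j = 0"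
    and empty: "\<And>j. j \<in> {Suc i..k} \<Longrightarrow> s j = 0 \<Longrightarrow> s (j - 1) = 0"
    and a_zero: "\<And>j. j \<in> {i..k} \<Longrightarrow> s j = 0 \<Longrightarrow> a j = 0"
    and "0 < s k" "i \<le> k"
  shows "0 \<le> (\<Prod>j=Suc i..k. U j)"
    and "a i \<le> (\<Prod>j=Suc i..k. U j) * a k"
    and "(\<And>j. j \<in> {Suc i..k} \<Longrightarrow> 0 \<le> L j) \<Longrightarrow> (\<Prod>j=Suc i..k. L j) * a k \<le> a i"
proof -
  \<comment> \<open>Downward induction from \<open>k\<close>. The clause for \<open>s h = 0\<close>
    carries the vanishing of the products along, so that a later unspecified factor is multiplied by
    0.\<close>
  have "0 \<le> (\<Prod>j=Suc h..k. U j) \<and> (s h = 0 \<longrightarrow> (\<Prod>j=Suc h..k. U j) = 0 \<and> (\<Prod>j=Suc h..k. L j) = 0) \<and>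
      a h \<le> (\<Prod>j=Suc h..k. U j) * a k \<and>
      ((\<forall>j \<in> {Suc i..k}. 0 \<le> L j) \<longrightarrow> (\<Prod>j=Suc h..k. L j) * a k \<le> a h)" if "i \<le> h" "h \<le> k" for h
    using \<open>h \<le> k\<close> \<open>i \<le> h\<close>
  proof (induction h rule: inc_induct)
    case base
    then show ?case using \<open>0 < s k\<close> by simp
  next
    case (step h)
    have j: "Suc h \<in> {Suc i..k}" and h: "h \<in> {i..k}" "Suc h \<in> {i..k}" using step by auto
    define PU PL where "PU = (\<Prod>j=Suc (Suc h)..k. U j)" and "PL = (\<Prod>j=Suc (Suc h)..k. L j)"
    have split: "(\<Prod>j=Suc h..k. U j) = U (Suc h) * PU" "(\<Prod>j=Suc h..k. L j) = L (Suc h) * PL"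
      using step.hyps by (simp_all add: PU_def PL_def prod.atLeast_Suc_atMost)
    have IH: "0 \<le> PU" "s (Suc h) = 0 \<Longrightarrow> PU = 0 \<and> PL = 0" "a (Suc h) \<le> PU * a k"
        "(\<forall>j \<in> {Suc i..k}. 0 \<le> L j) \<Longrightarrow> PL * a k \<le> a (Suc h)"
      using step.IH step.prems unfolding PU_def PL_def by simp_all
    show ?case
    proof (cases "s (Suc h) = 0")
      case True
      then have z: "PU = 0" "PL = 0" "a h = 0"
        using IH(2) empty[OF j] a_zero[OF h(1)] by simp_all
      show ?thesis
        unfolding split z by simp
    next
      case False
      then have b: "L (Suc h) * a (Suc h) \<le> a h" "a h \<le> U (Suc h) * a (Suc h)" "0 \<le> U (Suc h)"
        using assms(1)[OF j] by simp_all
      have "a h \<le> U (Suc h) * (PU * a k)"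
        using b(2) mult_left_mono[OF IH(3) b(3)] by linarith
      moreover have "L (Suc h) * (PL * a k) \<le> a h" if nn: "\<forall>j \<in> {Suc i..k}. 0 \<le> L j"
        using b(1) mult_left_mono[OF IH(4)[OF nn] bspec[OF nn j]] by linarith
      \<comment> \<open>The vanishing starts here: layer \<open>Suc h\<close> is nonempty and layer
        \<open>h\<close> is empty.\<close>
      moreover have "s h = 0 \<longrightarrow> L (Suc h) = 0 \<and> U (Suc h) = 0"
        using no_rows[OF j] False by simp
      ultimately show ?thesis
        unfolding split using mult_nonneg_nonneg[OF b(3) IH(1)] by (simp add: mult.assoc)
    qed
  qed
  note * = this[OF order_refl \<open>i \<le> k\<close>]
  show "0 \<le> (\<Prod>j=Suc i..k. U j)" "a i \<le> (\<Prod>j=Suc i..k. U j) * a k"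
    using * by blast+
  show "(\<Prod>j=Suc i..k. L j) * a k \<le> a i" if "\<And>j. j \<in> {Suc i..k} \<Longrightarrow> 0 \<le> L j"
    using * that by blast
qed

section \<open>Second moments of the noise and of its linear images\<close>

text \<open>On the diagonal this is the variance of a centred Gaussian; off the diagonal
  independence factors the expectation into two zero means.\<close>

lemma white_gaussian_noise_moments:
  assumes "prob_space M" "\<sigma> > 0" and noise: "white_gaussian_noise M n \<sigma> e"
    and jl: "j < n" "l < n"
  shows "integrable M (\<lambda>\<omega>. e \<omega> $ j * e \<omega> $ l)"
    and "prob_space.expectation M (\<lambda>\<omega>. e \<omega> $ j * e \<omega> $ l) = (if j = l then \<sigma>\<^sup>2 else 0)"
proof -
  interpret prob_space M by fact
  have D: "distributed M lborel (\<lambda>\<omega>. e \<omega> $ j) (normal_density 0 \<sigma>)" if "j < n" for j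
    using noise that by (simp add: white_gaussian_noise_def)
  have E0: "expectation (\<lambda>\<omega>. e \<omega> $ j) = 0" if "j < n" for j
    using normal_distributed_expectation[OF \<open>\<sigma> > 0\<close> D[OF that]] .
  have int1: "integrable M (\<lambda>\<omega>. e \<omega> $ j)" if "j < n" for j
    using distributed_integrable[OF D[OF that], of "\<lambda>x. x"] integrable_normal_moment[OF \<open>\<sigma> > 0\<close>, of 0 1]
    by simp
  have int2: "integrable M (\<lambda>\<omega>. (e \<omega> $ j)\<^sup>2)" if "j < n" for j
    using distributed_integrable[OF D[OF that], of "\<lambda>x. x\<^sup>2"] integrable_normal_moment[OF \<open>\<sigma> > 0\<close>, of 0 2]
    by simp
  have E2: "expectation (\<lambda>\<omega>. (e \<omega> $ j)\<^sup>2) = \<sigma>\<^sup>2" if "j < n" for j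
    using normal_distributed_variance[OF \<open>\<sigma> > 0\<close> D[OF that]] E0[OF that] by simp
  have indep: "indep_vars (\<lambda>_. borel) (\<lambda>j \<omega>. e \<omega> $ j) {j, l}"
    using noise jl indep_vars_subset[of "\<lambda>_. borel" "\<lambda>j \<omega>. e \<omega> $ j" "{..<n}" "{j, l}"]
    by (simp add: white_gaussian_noise_def)
  have int: "integrable M (\<lambda>\<omega>. e \<omega> $ j')" if "j' \<in> {j, l}" for j'
    using that int1 jl by auto
  have "integrable M (\<lambda>\<omega>. e \<omega> $ j * e \<omega> $ l) \<and>
      expectation (\<lambda>\<omega>. e \<omega> $ j * e \<omega> $ l) = (if j = l then \<sigma>\<^sup>2 else 0)"
  proof (cases "j = l")
    case True
    then show ?thesis
      using int2[OF jl(1)] E2[OF jl(1)] by (simp add: power2_eq_square)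
  next
    case False
    have prod: "(\<Prod>i\<in>{j, l}. f i) = f j * f l" for f :: "nat \<Rightarrow> real"
      using False by simp
    have fin: "finite {j, l}" by simp
    show ?thesis
      using indep_vars_integrable[OF fin indep int] indep_vars_lebesgue_integral[OF fin indep int]
        False E0[OF jl(1)] unfolding prod by simp
  qed
  then show "integrable M (\<lambda>\<omega>. e \<omega> $ j * e \<omega> $ l)"
    and "expectation (\<lambda>\<omega>. e \<omega> $ j * e \<omega> $ l) = (if j = l then \<sigma>\<^sup>2 else 0)"
    by blast+
qed

text \<open>Expanding the squares gives a quadratic form in the noise coordinates whose off-diagonal
  terms have mean 0; the diagonal leaves \<sigma> squared times the squared Frobenius norm.\<close>

lemma white_gaussian_noise_linear_image:
  assumes M: "prob_space M" "\<sigma> > 0" and noise: "white_gaussian_noise M n \<sigma> e"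
    and Q: "Q \<in> carrier_mat q n"
  shows "integrable M (\<lambda>\<omega>. sq_norm2 (Q *\<^sub>v e \<omega>))"
    and "prob_space.expectation M (\<lambda>\<omega>. sq_norm2 (Q *\<^sub>v e \<omega>)) = \<sigma>\<^sup>2 * (\<Sum>a<q. sq_norm2 (row Q a))"
proof -
  let ?E = "\<lambda>j l. if j = l then \<sigma>\<^sup>2 else 0"
  have eq: "sq_norm2 (Q *\<^sub>v e \<omega>)
      = (\<Sum>a<q. \<Sum>j<n. \<Sum>l<n. Q $$ (a, j) * Q $$ (a, l) * (e \<omega> $ j * e \<omega> $ l))"
    if "\<omega> \<in> space M" for \<omega>
  proof -
    have "e \<omega> \<in> carrier_vec n" using noise that by (simp add: white_gaussian_noise_def)
    then show ?thesis
      using Q by (simp add: sq_norm2_sum scalar_prod_def atLeast0LessThan power2_eq_square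
          sum_product mult_ac)
  qed
  have "has_bochner_integral M (\<lambda>\<omega>. e \<omega> $ j * e \<omega> $ l) (?E j l)" if "j < n" "l < n" for j l
    using white_gaussian_noise_moments[OF M noise that] by (simp add: has_bochner_integral_iff)
  then have "has_bochner_integral M
      (\<lambda>\<omega>. \<Sum>a<q. \<Sum>j<n. \<Sum>l<n. Q $$ (a, j) * Q $$ (a, l) * (e \<omega> $ j * e \<omega> $ l))
      (\<Sum>a<q. \<Sum>j<n. \<Sum>l<n. Q $$ (a, j) * Q $$ (a, l) * ?E j l)"
    by (intro has_bochner_integral_sum has_bochner_integral_mult_right) auto
  moreover have "(\<Sum>a<q. \<Sum>j<n. \<Sum>l<n. Q $$ (a, j) * Q $$ (a, l) * ?E j l)
      = (\<Sum>a<q. \<Sum>j<n. Q $$ (a, j) * Q $$ (a, j) * \<sigma>\<^sup>2)"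
    by (intro sum.cong refl) (simp add: if_distrib[of "\<lambda>x. _ * x"] cong: if_cong)
  moreover have "\<dots> = \<sigma>\<^sup>2 * (\<Sum>a<q. sq_norm2 (row Q a))"
    using Q by (simp add: sq_norm2_sum power2_eq_square sum_distrib_left mult_ac)
  ultimately have "has_bochner_integral M (\<lambda>\<omega>. sq_norm2 (Q *\<^sub>v e \<omega>))
      (\<sigma>\<^sup>2 * (\<Sum>a<q. sq_norm2 (row Q a)))"
    by (subst has_bochner_integral_cong[OF refl eq refl]) simp_all
  then show "integrable M (\<lambda>\<omega>. sq_norm2 (Q *\<^sub>v e \<omega>))"
    "prob_space.expectation M (\<lambda>\<omega>. sq_norm2 (Q *\<^sub>v e \<omega>)) = \<sigma>\<^sup>2 * (\<Sum>a<q. sq_norm2 (row Q a))"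
    by (simp_all add: has_bochner_integral_iff)
qed

section \<open>Layer products and the kernel of the stacked matrix\<close>

lemma restrict_vec_UNIV: "restrict_vec v UNIV = v"
  by (rule eq_vecI) (simp_all add: restrict_vec_def pick_UNIV)

lemma layer_prod_refl: "layer_prod D l l = D l"
  by (simp add: layer_prod_def)

lemma layer_prod_Suc: "l \<le> j \<Longrightarrow> layer_prod D l (Suc j) = layer_prod D l j * D (Suc j)"
  by (simp add: layer_prod_def)

text \<open>Induction on the right end, where \<open>layer_prod\<close> grows. The index
  \<open>l - 1\<close> may be 0, which lets the signal itself serve as layer 0.\<close>

lemma layer_prod_mult_vec:
  assumes "l \<le> k"
    and "\<And>j. j \<in> {l..k} \<Longrightarrow> D j \<in> carrier_mat (d (j - 1)) (d j)"
    and "\<And>j. j \<in> {l..k} \<Longrightarrow> g j \<in> carrier_vec (d j)"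
    and "\<And>j. j \<in> {l..k} \<Longrightarrow> g (j - 1) = D j *\<^sub>v g j"
  shows "layer_prod D l k \<in> carrier_mat (d (l - 1)) (d k) \<and> layer_prod D l k *\<^sub>v g k = g (l - 1)"
  using assms
proof (induction k rule: dec_induct)
  case base
  then show ?case by (simp add: layer_prod_refl)
next
  case (step j)
  have IH: "layer_prod D l j \<in> carrier_mat (d (l - 1)) (d j)" "layer_prod D l j *\<^sub>v g j = g (l - 1)"
    using step by auto
  have D: "D (Suc j) \<in> carrier_mat (d j) (d (Suc j))" and g: "g (Suc j) \<in> carrier_vec (d (Suc j))"
    and gj: "g j = D (Suc j) *\<^sub>v g (Suc j)"
    using step.prems(1)[of "Suc j"] step.prems(2)[of "Suc j"] step.prems(3)[of "Suc j"] step.hyps by auto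
  have "(layer_prod D l j * D (Suc j)) *\<^sub>v g (Suc j) = g (l - 1)"
    using assoc_mult_mat_vec[OF IH(1) D g] IH(2) gj by simp
  then show ?case
    using IH(1) D step.hyps by (simp add: layer_prod_Suc)
qed

lemma restrict_vec_complement_support:
  assumes "b < dim_vec (restrict_vec v (- support_vec v))"
  shows "restrict_vec v (- support_vec v) $ b = 0"
proof -
  let ?J = "- support_vec v"
  have "b < card {j. j < dim_vec v \<and> j \<in> ?J}"
    using assms by (simp only: dim_restrict_vec)
  then have "pick ?J b \<in> {j. j < dim_vec v \<and> j \<in> ?J}"
    by (intro bij_betw_apply[OF bij_betw_pick]) simp
  then show ?thesis
    using assms by (simp add: restrict_vec_def support_vec_def)
qed

text \<open>Block \<open>l\<close> sends the restricted vector to the entries of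
  \<open>g (l - 1)\<close> off its support, which are 0. For \<open>k = 1\<close> there are no
  blocks and the kernel is the whole space.\<close>

lemma restrict_vec_in_kernel_stacked_mat:
  assumes D: "\<And>l. l \<in> {2..k} \<Longrightarrow> layer_prod D l k \<in> carrier_mat (d (l - 1)) q"
    and image: "\<And>l. l \<in> {2..k} \<Longrightarrow> layer_prod D l k *\<^sub>v v = g (l - 1)"
    and supp: "\<And>l. l \<in> {2..k} \<Longrightarrow> \<Lambda> (l - 1) = support_vec (g (l - 1))"
    and v: "v \<in> carrier_vec q" and \<Lambda>k: "\<Lambda> k = support_vec v"
  shows "restrict_vec v (\<Lambda> k) \<in> mat_kernel (stacked_mat D \<Lambda> k)"
proof (rule mat_kernelI)
  let ?s = "card (\<Lambda> k)" and ?G = "restrict_vec v (\<Lambda> k)"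
  define B where "B l = submatrix (layer_prod D l k) (- \<Lambda> (l - 1)) (\<Lambda> k)" for l
  define R where "R = concat (map (\<lambda>l. rows (B l)) [2..<Suc k])"
  have \<Lambda>sub: "\<Lambda> k \<subseteq> {..<q}"
    using v by (auto simp: \<Lambda>k support_vec_def)
  have stacked: "stacked_mat D \<Lambda> k = mat_of_rows ?s R"
    by (simp only: stacked_mat_def R_def B_def)
  show "stacked_mat D \<Lambda> k \<in> carrier_mat (length R) ?s"
    by (simp add: stacked)
  show G: "?G \<in> carrier_vec ?s"
    by (rule restrict_vec_carrier[OF v \<Lambda>sub])
  have row: "w \<in> carrier_vec ?s \<and> w \<bullet> ?G = 0" if wR: "w \<in> set R" for w
  proof -
    obtain l where l: "l \<in> {2..k}" and "w \<in> set (rows (B l))"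
      using wR by (auto simp: R_def atLeastLessThanSuc_atLeastAtMost simp del: upt_Suc)
    then obtain b where b: "b < dim_row (B l)" and w: "w = row (B l) b"
      by (auto simp: in_set_conv_nth)
    have "{j. j < dim_col (layer_prod D l k) \<and> j \<in> \<Lambda> k} = \<Lambda> k"
      using D[OF l] \<Lambda>sub by auto
    then have "dim_col (B l) = ?s"
      by (simp only: B_def dim_submatrix)
    then have "w \<in> carrier_vec ?s"
      by (simp add: w carrier_vecI)
    moreover have BG: "B l *\<^sub>v ?G = restrict_vec (g (l - 1)) (- support_vec (g (l - 1)))"
    proof -
      have "B l *\<^sub>v ?G = restrict_vec (layer_prod D l k *\<^sub>v v) (- \<Lambda> (l - 1))"
        unfolding B_def using v
        by (intro submatrix_mult_restrict_vec[OF D[OF l] v]) (simp add: \<Lambda>k support_vec_def)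
      then show ?thesis by (simp only: image[OF l] supp[OF l])
    qed
    have "w \<bullet> ?G = (B l *\<^sub>v ?G) $ b"
      using b by (simp add: w)
    moreover have "(B l *\<^sub>v ?G) $ b = 0"
    proof -
      have "b < dim_vec (B l *\<^sub>v ?G)" using b by simp
      then show ?thesis
        unfolding BG by (rule restrict_vec_complement_support)
    qed
    ultimately show ?thesis by simp
  qed
  show "stacked_mat D \<Lambda> k *\<^sub>v ?G = 0\<^sub>v (length R)"
    unfolding stacked
  proof (rule eq_vecI)
    fix a assume "a < dim_vec (0\<^sub>v (length R) :: real vec)"
    then have a: "a < length R" by simp
    then have "row (mat_of_rows ?s R) a = R ! a"
      using row[of "R ! a"] by simp
    then show "(mat_of_rows ?s R *\<^sub>v ?G) $ a = 0\<^sub>v (length R) $ a"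
      using a row[of "R ! a"] by simp
  qed simp
qed

section \<open>Mean squared error of the oracle estimators\<close>

text \<open>Layerwise lower bounds multiply when their factors are nonnegative, and a nonpositive
  product makes the lower bound trivial. A positive product with an even, nonzero number of negative
  factors falls under neither argument, hence the guard. Integrability is asserted because the
  integral of a non-integrable function is 0 by convention.\<close>

theorem mainTheorem4:
  fixes M :: "'w measure"
    and n k i r :: nat
    and m s :: "nat \<Rightarrow> nat"
    and D :: "nat \<Rightarrow> real mat"
    and \<gamma> :: "nat \<Rightarrow> real vec"
    and \<Lambda> :: "nat \<Rightarrow> nat set"
    and x :: "real vec"
    and e y :: "'w \<Rightarrow> real vec"
    and \<sigma> :: real
    and K :: "real mat"
    and est :: "'w \<Rightarrow> nat \<Rightarrow> real vec"
  assumes "prob_space M"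
    and "D 1 \<in> carrier_mat n (m 1)"
    and "\<And>j. j \<in> {2..k} \<Longrightarrow> D j \<in> carrier_mat (m (j - 1)) (m j)"
    and "\<And>j. j \<in> {1..k} \<Longrightarrow> \<gamma> j \<in> carrier_vec (m j)"
    and "x = D 1 *\<^sub>v \<gamma> 1"
    and "\<And>j. j \<in> {2..k} \<Longrightarrow> \<gamma> (j - 1) = D j *\<^sub>v \<gamma> j"
    and "\<And>j. j \<in> {1..k} \<Longrightarrow> \<Lambda> j = support_vec (\<gamma> j)"
    and "\<And>j. j \<in> {1..k} \<Longrightarrow> s j = card (\<Lambda> j)"
    and "\<sigma> > 0"
    and "white_gaussian_noise M n \<sigma> e"
    and "\<And>\<omega>. \<omega> \<in> space M \<Longrightarrow> y \<omega> = x + e \<omega>"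
    and "rip_const (layer_prod D 1 k) (s k) < 1"
    and "r = vec_space.rank (dim_row (stacked_mat D \<Lambda> k)) (stacked_mat D \<Lambda> k)"
    and "K \<in> carrier_mat (s k) (s k - r)"
    and "orthonormal_cols K"
    and "vec_space.col_space (s k) K = mat_kernel (stacked_mat D \<Lambda> k)"
    and "\<And>\<omega>. \<omega> \<in> space M \<Longrightarrow> holistic_oracle_estimators D m \<Lambda> k K (y \<omega>) (est \<omega>)"
    and "1 \<le> i" and "i \<le> k"
  shows "integrable M (\<lambda>\<omega>. sq_norm2 (\<gamma> i - est \<omega> i)) \<and>
    ((\<forall>j \<in> {i+1..k}. 0 \<le> (real (s (j - 1)) / real (m (j - 1)) - subset_rip_const (D j) (s (j - 1)) (s j))) \<or>
     (\<Prod>j = i+1..k. (real (s (j - 1)) / real (m (j - 1)) - subset_rip_const (D j) (s (j - 1)) (s j))) \<le> 0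
     \<longrightarrow>
     \<sigma>\<^sup>2 * (real (s k) - real r) *
         (\<Prod>j = i+1..k. (real (s (j - 1)) / real (m (j - 1)) - subset_rip_const (D j) (s (j - 1)) (s j))) /
         (1 + rip_const (layer_prod D 1 k) (s k))
       \<le> prob_space.expectation M (\<lambda>\<omega>. sq_norm2 (\<gamma> i - est \<omega> i))) \<and>
    prob_space.expectation M (\<lambda>\<omega>. sq_norm2 (\<gamma> i - est \<omega> i))
      \<le> \<sigma>\<^sup>2 * (real (s k) - real r) *
         (\<Prod>j = i+1..k. (real (s (j - 1)) / real (m (j - 1)) + subset_rip_const (D j) (s (j - 1)) (s j))) /
         (1 - rip_const (layer_prod D 1 k) (s k))"
proof -
  let ?\<delta> = "rip_const (layer_prod D 1 k) (s k)"
  let ?S = "\<lambda>j. submatrix (D j) (\<Lambda> (j - 1)) (\<Lambda> j)"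
  let ?L = "\<lambda>j. real (s (j - 1)) / real (m (j - 1)) - subset_rip_const (D j) (s (j - 1)) (s j)"
  let ?U = "\<lambda>j. real (s (j - 1)) / real (m (j - 1)) + subset_rip_const (D j) (s (j - 1)) (s j)"
  interpret prob_space M by fact
  note D = assms(3) and \<gamma> = assms(4) and \<gamma>_step = assms(6) and \<Lambda> = assms(7) and s = assms(8)
    and noise = assms(10) and K = assms(14,15) and est = assms(17)
  have k: "1 \<le> k" using assms(18,19) by simp
  have \<Lambda>_sub: "\<Lambda> j \<subseteq> {..<m j}" if "j \<in> {1..k}" for j
    using \<gamma>[OF that] by (auto simp: \<Lambda>[OF that] support_vec_def)
  have \<gamma>_out: "\<gamma> j $ b = 0" if "j \<in> {1..k}" "b < m j" "b \<notin> \<Lambda> j" for j b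
    using that \<gamma>[OF that(1)] by (simp add: \<Lambda>[OF that(1)] support_vec_def)
  have s_le: "s j \<le> m j" if "j \<in> {1..k}" for j
    using card_mono[OF _ \<Lambda>_sub[OF that]] s[OF that] by simp
  have S: "?S j \<in> carrier_mat (s (j - 1)) (s j)" if "j \<in> {2..k}" for j
  proof -
    have j: "j \<in> {1..k}" "j - 1 \<in> {1..k}" using that by auto
    show ?thesis
      unfolding s[OF j(1)] s[OF j(2)]
      by (rule submatrix_carrier[OF D[OF that] \<Lambda>_sub[OF j(2)] \<Lambda>_sub[OF j(1)]])
  qed

  \<comment> \<open>With \<open>n\<close> and \<open>x\<close> entered as layer 0, the relation for
    the signal and those between representations become a single recursion.\<close>
  define d where "d = m(0 := n)"
  define g where "g = \<gamma>(0 := x)"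
  have chain: "D j \<in> carrier_mat (d (j - 1)) (d j) \<and> g j \<in> carrier_vec (d j) \<and> g (j - 1) = D j *\<^sub>v g j"
    if "j \<in> {1..k}" for j
  proof (cases "j = 1")
    case True
    then show ?thesis
      using assms(2,5) \<gamma>[OF that] by (simp add: d_def g_def)
  next
    case False
    then have "j \<in> {2..k}" using that by auto
    then show ?thesis
      using D[of j] \<gamma>[OF that] \<gamma>_step[of j] by (simp add: d_def g_def)
  qed
  have layer: "layer_prod D l k \<in> carrier_mat (d (l - 1)) (m k) \<and> layer_prod D l k *\<^sub>v \<gamma> k = g (l - 1)"
    if "l \<in> {1..k}" for l
    using layer_prod_mult_vec[of l k D d g] chain that k by (auto simp: d_def g_def)

  define A where "A = submatrix (layer_prod D 1 k) UNIV (\<Lambda> k)"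
  define G where "G = restrict_vec (\<gamma> k) (\<Lambda> k)"
  have kk: "k \<in> {1..k}" using k by simp
  have W: "layer_prod D 1 k \<in> carrier_mat n (m k)" "layer_prod D 1 k *\<^sub>v \<gamma> k = x"
    using layer[of 1] k by (simp_all add: d_def g_def)
  have A: "A \<in> carrier_mat n (s k)"
    using submatrix_UNIV_carrier[OF W(1) \<Lambda>_sub[OF kk]] s[OF kk] by (simp add: A_def)
  have AG: "A *\<^sub>v G = x"
    unfolding A_def G_def
    using submatrix_mult_restrict_vec[OF W(1) \<gamma>[OF kk] \<gamma>_out[OF kk]] W(2)
    by (simp add: restrict_vec_UNIV)
  have "G \<in> mat_kernel (stacked_mat D \<Lambda> k)"
    unfolding G_def
  proof (rule restrict_vec_in_kernel_stacked_mat[where d = d and g = \<gamma>])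
    fix l assume "l \<in> {2..k}"
    then have l: "l \<in> {1..k}" "l - 1 \<in> {1..k}" "l - 1 \<noteq> 0" by auto
    from l(3) have gl: "g (l - 1) = \<gamma> (l - 1)"
      unfolding g_def by (rule fun_upd_other)
    show "layer_prod D l k \<in> carrier_mat (d (l - 1)) (m k)" "layer_prod D l k *\<^sub>v \<gamma> k = \<gamma> (l - 1)"
      "\<Lambda> (l - 1) = support_vec (\<gamma> (l - 1))"
      using layer[OF l(1)] \<Lambda>[OF l(2)] by (simp_all only: gl)
  qed (use \<gamma>[OF kk] \<Lambda>[OF kk] in auto)
  then have "G \<in> vec_space.col_space (s k) K"
    using assms(16) by simp
  then obtain c where c: "c \<in> carrier_vec (s k - r)" and Kc: "K *\<^sub>v c = G"
    using vec_space.col_space_eq[OF K(1)] K(1) by auto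

  define B where "B = A * K"
  define P where "P = pseudo_inverse B"
  have B: "B \<in> carrier_mat n (s k - r)"
    using A K by (simp add: B_def)
  have Bv: "B *\<^sub>v v = A *\<^sub>v (K *\<^sub>v v)" if "v \<in> carrier_vec (s k - r)" for v
    unfolding B_def using A K that by simp
  have \<delta>: "0 \<le> ?\<delta>" "?\<delta> < 1"
    using rip_const_nonneg[OF W(1)] assms(12) by auto
  \<comment> \<open>\<open>K\<close> preserves norms, so \<open>B\<close> inherits the RIP bounds of
    \<open>A\<close>.\<close>
  have B_bounds: "(1 - ?\<delta>) * sq_norm2 v \<le> sq_norm2 (B *\<^sub>v v)" "sq_norm2 (B *\<^sub>v v) \<le> (1 + ?\<delta>) * sq_norm2 v"
    if v: "v \<in> carrier_vec (s k - r)" for v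
  proof -
    have Kv: "K *\<^sub>v v \<in> carrier_vec (card (\<Lambda> k))"
      using K v s[OF kk] by simp
    show "(1 - ?\<delta>) * sq_norm2 v \<le> sq_norm2 (B *\<^sub>v v)" "sq_norm2 (B *\<^sub>v v) \<le> (1 + ?\<delta>) * sq_norm2 v"
      using rip_const_bounds[OF W(1) \<Lambda>_sub[OF kk] Kv] sq_norm2_orthonormal_cols[OF K v]
      by (simp_all add: Bv[OF v] A_def s[OF kk])
  qed
  have inj: "v = 0\<^sub>v (s k - r)" if "v \<in> carrier_vec (s k - r)" "B *\<^sub>v v = 0\<^sub>v n" for v
  proof (rule sq_norm2_eq_0_D[OF that(1)])
    have "(1 - ?\<delta>) * sq_norm2 v \<le> 0"
      using B_bounds(1)[OF that(1)] by (simp add: that(2) sq_norm2_zero)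
    then show "sq_norm2 v = 0"
      using \<delta> sq_norm2_nonneg[of v] by (simp add: mult_le_0_iff)
  qed
  have P: "P \<in> carrier_mat (s k - r) n" and PB: "P * B = 1\<^sub>m (s k - r)"
    unfolding P_def using pseudo_inverse_injective[OF B inj] by auto

  \<comment> \<open>Restriction loses no norm, since the estimate and the true vector both vanish
    off the support. The sign is chosen so that \<open>u k\<close> is a linear image of
    \<open>e\<close> without a minus.\<close>
  define u where "u j \<omega> = restrict_vec (est \<omega> j) (\<Lambda> j) - restrict_vec (\<gamma> j) (\<Lambda> j)" for j \<omega>
  have e: "e \<omega> \<in> carrier_vec n" if "\<omega> \<in> space M" for \<omega>
    using noise that by (simp add: white_gaussian_noise_def)
  have est_carrier: "est \<omega> j \<in> carrier_vec (m j)" and est_out: "\<And>b. b < m j \<Longrightarrow> b \<notin> \<Lambda> j \<Longrightarrow> est \<omega> j $ b = 0"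
    if "\<omega> \<in> space M" "j \<in> {1..k}" for \<omega> j
    using est[OF that(1)] that(2) by (auto simp: holistic_oracle_estimators_def)
  have res: "restrict_vec (est \<omega> j) (\<Lambda> j) \<in> carrier_vec (s j)" "restrict_vec (\<gamma> j) (\<Lambda> j) \<in> carrier_vec (s j)"
    if "\<omega> \<in> space M" "j \<in> {1..k}" for \<omega> j
    using restrict_vec_carrier[OF est_carrier[OF that] \<Lambda>_sub[OF that(2)]]
      restrict_vec_carrier[OF \<gamma>[OF that(2)] \<Lambda>_sub[OF that(2)]] s[OF that(2)] by simp_all
  have u_carrier: "u j \<omega> \<in> carrier_vec (s j)" if "\<omega> \<in> space M" "j \<in> {1..k}" for \<omega> j
    using res[OF that] by (simp add: u_def)
  have error_u: "sq_norm2 (\<gamma> j - est \<omega> j) = sq_norm2 (u j \<omega>)" if "\<omega> \<in> space M" "j \<in> {1..k}" for \<omega> j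
  proof -
    have "sq_norm2 (\<gamma> j - est \<omega> j) = sq_norm2 (est \<omega> j - \<gamma> j)"
      by (rule sq_norm2_minus_commute[OF \<gamma>[OF that(2)] est_carrier[OF that]])
    also have "\<dots> = sq_norm2 (restrict_vec (est \<omega> j - \<gamma> j) (\<Lambda> j))"
      by (rule sq_norm2_restrict_vec[of _ "m j", symmetric])
         (use \<gamma>[OF that(2)] est_carrier[OF that] est_out[OF that] \<gamma>_out[OF that(2)] in auto)
    also have "restrict_vec (est \<omega> j - \<gamma> j) (\<Lambda> j) = u j \<omega>"
      unfolding u_def by (rule restrict_vec_minus[OF est_carrier[OF that] \<gamma>[OF that(2)]])
    finally show ?thesis .
  qed
  \<comment> \<open>Since \<open>P B = 1\<close>, the signal part \<open>B c\<close> is recovered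
    exactly as \<open>c\<close>, and only the noise contributes to the error.\<close>
  have u_k: "u k \<omega> = K *\<^sub>v (P *\<^sub>v e \<omega>)" if \<omega>: "\<omega> \<in> space M" for \<omega>
  proof -
    have Pe: "P *\<^sub>v e \<omega> \<in> carrier_vec (s k - r)"
      using P e[OF \<omega>] by simp
    have "y \<omega> = B *\<^sub>v c + e \<omega>"
      using assms(11)[OF \<omega>] by (simp add: Bv[OF c] Kc AG)
    then have "P *\<^sub>v y \<omega> = P *\<^sub>v (B *\<^sub>v c) + P *\<^sub>v e \<omega>"
      using mult_add_distrib_mat_vec[OF P, of "B *\<^sub>v c" "e \<omega>"] B c e[OF \<omega>] by simp
    also have "P *\<^sub>v (B *\<^sub>v c) = c"
      using assoc_mult_mat_vec[OF P B c] PB c by simp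
    finally have "K *\<^sub>v (P *\<^sub>v y \<omega>) = G + K *\<^sub>v (P *\<^sub>v e \<omega>)"
      using mult_add_distrib_mat_vec[OF K(1) c Pe] by (simp add: Kc)
    moreover have "restrict_vec (est \<omega> k) (\<Lambda> k) = K *\<^sub>v (P *\<^sub>v y \<omega>)"
      using est[OF \<omega>] by (simp add: holistic_oracle_estimators_def P_def B_def A_def)
    moreover have "G + w - G = w" if "w \<in> carrier_vec (s k)" for w
      using that res(2)[OF \<omega> kk] by (intro eq_vecI) (auto simp: G_def)
    ultimately show ?thesis
      using K(1) Pe by (simp add: u_def G_def)
  qed
  \<comment> \<open>The estimates obey this recursion by definition, and the true vectors obey it
    because they vanish off their supports; the difference inherits it by linearity.\<close>
  have u_step: "u (j - 1) \<omega> = ?S j *\<^sub>v u j \<omega>" if \<omega>: "\<omega> \<in> space M" and j: "j \<in> {2..k}" for \<omega> j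
  proof -
    have j': "j \<in> {1..k}" "j - 1 \<in> {1..<k}" "j - 1 + 1 = j" using j by auto
    have "\<forall>i \<in> {1..<k}. restrict_vec (est \<omega> i) (\<Lambda> i) =
        submatrix (D (i + 1)) (\<Lambda> i) (\<Lambda> (i + 1)) *\<^sub>v restrict_vec (est \<omega> (i + 1)) (\<Lambda> (i + 1))"
      using est[OF \<omega>] unfolding holistic_oracle_estimators_def by (elim conjE)
    from bspec[OF this j'(2)]
    have 1: "restrict_vec (est \<omega> (j - 1)) (\<Lambda> (j - 1)) = ?S j *\<^sub>v restrict_vec (est \<omega> j) (\<Lambda> j)"
      by (simp only: j'(3))
    have 2: "restrict_vec (\<gamma> (j - 1)) (\<Lambda> (j - 1)) = ?S j *\<^sub>v restrict_vec (\<gamma> j) (\<Lambda> j)"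
      using submatrix_mult_restrict_vec[OF D[OF j] \<gamma>[OF j'(1)] \<gamma>_out[OF j'(1)]] \<gamma>_step[OF j] by simp
    show ?thesis
      unfolding u_def 1 2
      by (rule mult_minus_distrib_mat_vec[OF S[OF j] res[OF \<omega> j'(1)], symmetric])
  qed
  \<comment> \<open>The composed matrix \<open>Q\<close> serves to show that the squared error at
    layer \<open>i\<close> is integrable; its size is controlled separately by the pointwise
    chain.\<close>
  have "\<exists>Q \<in> carrier_mat (s i) n. \<forall>\<omega> \<in> space M. u i \<omega> = Q *\<^sub>v e \<omega>"
    using assms(19,18)
  proof (induction i rule: inc_induct)
    case base
    have "\<forall>\<omega> \<in> space M. u k \<omega> = (K * P) *\<^sub>v e \<omega>"
      using u_k assoc_mult_mat_vec[OF K(1) P e] by simp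
    then show ?case
      using K(1) P by (intro bexI[of _ "K * P"]) auto
  next
    case (step h)
    then obtain Q where Q: "Q \<in> carrier_mat (s (Suc h)) n" "\<forall>\<omega> \<in> space M. u (Suc h) \<omega> = Q *\<^sub>v e \<omega>"
      by auto
    have j: "Suc h \<in> {2..k}" using step by auto
    have "\<forall>\<omega> \<in> space M. u h \<omega> = (?S (Suc h) * Q) *\<^sub>v e \<omega>"
      using u_step[OF _ j] Q(2) assoc_mult_mat_vec[OF S[OF j] Q(1) e] by simp
    moreover have "?S (Suc h) * Q \<in> carrier_mat (s h) n"
      using S[OF j] Q(1) by simp
    ultimately show ?case by blast
  qed
  then obtain Q where Q: "Q \<in> carrier_mat (s i) n" "\<And>\<omega>. \<omega> \<in> space M \<Longrightarrow> u i \<omega> = Q *\<^sub>v e \<omega>"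
    by blast
  have ii: "i \<in> {1..k}" using assms(18,19) by simp

  let ?X = "\<lambda>\<omega>. sq_norm2 (\<gamma> i - est \<omega> i)" and ?Y = "\<lambda>\<omega>. sq_norm2 (P *\<^sub>v e \<omega>)"
  have X: "?X \<omega> = sq_norm2 (u i \<omega>)" if "\<omega> \<in> space M" for \<omega>
    using error_u[OF that ii] .
  have Y: "sq_norm2 (u k \<omega>) = ?Y \<omega>" if "\<omega> \<in> space M" for \<omega>
    using sq_norm2_orthonormal_cols[OF K, of "P *\<^sub>v e \<omega>"] P e[OF that] by (simp add: u_k[OF that])
  have "integrable M (\<lambda>\<omega>. sq_norm2 (Q *\<^sub>v e \<omega>))"
    by (rule white_gaussian_noise_linear_image(1)[OF assms(1,9) noise Q(1)])
  moreover have "integrable M ?X = integrable M (\<lambda>\<omega>. sq_norm2 (Q *\<^sub>v e \<omega>))"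
    by (rule Bochner_Integration.integrable_cong[OF refl]) (simp only: X Q(2))
  ultimately have int_X: "integrable M ?X" by simp
  have int_Y: "integrable M ?Y"
    by (rule white_gaussian_noise_linear_image(1)[OF assms(1,9) noise P])
  have EY: "expectation ?Y = \<sigma>\<^sup>2 * (\<Sum>a<s k - r. sq_norm2 (row P a))"
    by (rule white_gaussian_noise_linear_image(2)[OF assms(1,9) noise P])
  \<comment> \<open>The subtraction in \<open>s k - r\<close> is truncated; this inequality
    identifies it with the real difference in the bounds.\<close>
  have "r \<le> s k"
    unfolding assms(13) by (rule vec_space.rank_le_nc) (simp add: carrier_matI stacked_mat_def s[OF kk])
  then have dim: "real (s k - r) = real (s k) - real r" by simp
  have rows: "1 / (1 + ?\<delta>) \<le> sq_norm2 (row P a)" "sq_norm2 (row P a) \<le> 1 / (1 - ?\<delta>)" if "a < s k - r" for a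
    unfolding P_def using pseudo_inverse_row_bounds[OF B _ B_bounds that] \<delta> by auto
  have Y_lower: "\<sigma>\<^sup>2 * (real (s k) - real r) / (1 + ?\<delta>) \<le> expectation ?Y"
  proof -
    have "real (s k - r) * (1 / (1 + ?\<delta>)) \<le> (\<Sum>a<s k - r. sq_norm2 (row P a))"
      using sum_bounded_below[of "{..<s k - r}" "1 / (1 + ?\<delta>)"] rows by simp
    from mult_left_mono[OF this, of "\<sigma>\<^sup>2"] show ?thesis
      by (simp add: EY dim)
  qed
  have Y_upper: "expectation ?Y \<le> \<sigma>\<^sup>2 * (real (s k) - real r) / (1 - ?\<delta>)"
  proof -
    have "(\<Sum>a<s k - r. sq_norm2 (row P a)) \<le> real (s k - r) * (1 / (1 - ?\<delta>))"
      using sum_bounded_above[of "{..<s k - r}" _ "1 / (1 - ?\<delta>)"] rows by simp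
    from mult_left_mono[OF this, of "\<sigma>\<^sup>2"] show ?thesis
      by (simp add: EY dim)
  qed

  \<comment> \<open>An empty support means a zero vector, and \<open>D j\<close> maps it to zero at
    the layer above the signal side, so emptiness propagates from \<open>j\<close> to
    \<open>j - 1\<close>.\<close>
  have empty: "s (j - 1) = 0" if j: "j \<in> {2..k}" and "s j = 0" for j
  proof -
    have j': "j \<in> {1..k}" "j - 1 \<in> {1..k}" using j by auto
    have "\<Lambda> j = {}"
      using that(2) s[OF j'(1)] finite_subset[OF \<Lambda>_sub[OF j'(1)]] by simp
    then have "\<gamma> j = 0\<^sub>v (m j)"
      using \<gamma>[OF j'(1)] \<gamma>_out[OF j'(1)] by (intro eq_vecI) auto
    then have "\<gamma> (j - 1) = 0\<^sub>v (m (j - 1))"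
      using \<gamma>_step[OF j] D[OF j] by (intro eq_vecI) auto
    then show ?thesis
      using s[OF j'(2)] \<Lambda>[OF j'(2)] by (simp add: support_vec_def)
  qed
  have step_sub: "j \<in> {2..k}" if "j \<in> {Suc i..k}" for j
    using that ii by auto
  show ?thesis
  proof (cases "s k = 0")
    case True
    \<comment> \<open>Here the products may contain unspecified constants, but they are multiplied
      by \<open>s k - r = 0\<close>, and the error is 0 as well.\<close>
    have "s i = 0"
      using assms(19,18)
    proof (induction i rule: inc_induct)
      case (step h)
      then show ?case using empty[of "Suc h"] by simp
    qed (rule True)
    then have "?X \<omega> = 0" if "\<omega> \<in> space M" for \<omega>
      using u_carrier[OF that ii] by (simp add: X[OF that] sq_norm2_dim0)
    then have "expectation ?X = expectation (\<lambda>_. 0)"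
      by (intro Bochner_Integration.integral_cong) simp_all
    then have "expectation ?X = 0" by simp
    moreover have "real (s k) - real r = 0"
      using dim True by simp
    ultimately show ?thesis
      using int_X by simp
  next
    case False
    have step: "?L j * sq_norm2 (u j \<omega>) \<le> sq_norm2 (u (j - 1) \<omega>) \<and>
        sq_norm2 (u (j - 1) \<omega>) \<le> ?U j * sq_norm2 (u j \<omega>) \<and> 0 \<le> ?U j"
      if \<omega>: "\<omega> \<in> space M" and j: "j \<in> {Suc i..k}" and pos: "0 < s j" for \<omega> j
    proof -
      have j2: "j \<in> {2..k}" by (rule step_sub[OF j])
      then have j': "j \<in> {1..k}" "j - 1 \<in> {1..k}" by auto
      have bounds: "?L j * sq_norm2 v \<le> sq_norm2 (?S j *\<^sub>v v)" "sq_norm2 (?S j *\<^sub>v v) \<le> ?U j * sq_norm2 v"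
        if "v \<in> carrier_vec (s j)" for v
        using subset_rip_const_bounds[OF D[OF j2] \<Lambda>_sub[OF j'(2)] \<Lambda>_sub[OF j'(1)], of v] that
        unfolding s[OF j'(1)] s[OF j'(2)] by blast+
      \<comment> \<open>The upper RIP inequality for a unit vector bounds a squared norm by
        \<open>?U j\<close>, forcing it to be nonnegative.\<close>
      have "0 \<le> ?U j * sq_norm2 (unit_vec (s j) 0)"
        by (rule order_trans[OF sq_norm2_nonneg bounds(2)]) simp
      then have "0 \<le> ?U j"
        using pos by (simp add: sq_norm2_unit_vec)
      then show ?thesis
        using bounds[OF u_carrier[OF \<omega> j'(1)]] unfolding u_step[OF \<omega> j2] by blast
    qed
    have no_rows: "?L j = 0 \<and> ?U j = 0" if "j \<in> {Suc i..k}" "0 < s j" "s (j - 1) = 0" for j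
    proof -
      have j: "j \<in> {2..k}" by (rule step_sub[OF that(1)])
      then have "subset_rip_const (D j) 0 (s j) = 0"
        by (intro subset_rip_const_no_rows[OF D that(2) s_le]) auto
      then show ?thesis
        unfolding that(3) by simp
    qed
    have u_zero: "sq_norm2 (u j \<omega>) = 0" if "\<omega> \<in> space M" "j \<in> {i..k}" "s j = 0" for \<omega> j
      using u_carrier[OF that(1), of j] that(2,3) ii by (intro sq_norm2_dim0) auto
    have empty': "s (j - 1) = 0" if "j \<in> {Suc i..k}" "s j = 0" for j
      using empty[OF step_sub] that by blast
    have "0 < s k" using False by simp
    have chain: "0 \<le> (\<Prod>j=Suc i..k. ?U j)" "?X \<omega> \<le> (\<Prod>j=Suc i..k. ?U j) * ?Y \<omega>"
      "(\<And>j. j \<in> {Suc i..k} \<Longrightarrow> 0 \<le> ?L j) \<Longrightarrow> (\<Prod>j=Suc i..k. ?L j) * ?Y \<omega> \<le> ?X \<omega>"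
      if \<omega>: "\<omega> \<in> space M" for \<omega>
      using chain_bounds[where a = "\<lambda>j. sq_norm2 (u j \<omega>)" and i = i and k = k and s = s and L = ?L and U = ?U,
        OF step[OF \<omega>] no_rows empty' u_zero[OF \<omega>] \<open>0 < s k\<close> assms(19)]
      unfolding X[OF \<omega>] Y[OF \<omega>] by blast+
    have reorder: "p * (a * b / c) = a * b * p / c" for p a b c :: real
      by simp
    \<comment> \<open>The product of the upper factors is independent of the sample, but
      \<open>chain\<close> gives its sign only at a sample point; a probability space has
      one.\<close>
    obtain \<omega>\<^sub>0 where "\<omega>\<^sub>0 \<in> space M" using not_empty by blast
    then have U_nonneg: "0 \<le> (\<Prod>j=Suc i..k. ?U j)"
      by (rule chain(1))
    have "expectation ?X \<le> expectation (\<lambda>\<omega>. (\<Prod>j=Suc i..k. ?U j) * ?Y \<omega>)"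
    proof (rule integral_mono[OF int_X])
      show "integrable M (\<lambda>\<omega>. (\<Prod>j=Suc i..k. ?U j) * ?Y \<omega>)"
        using int_Y by (rule integrable_mult_right)
      show "?X \<omega> \<le> (\<Prod>j=Suc i..k. ?U j) * ?Y \<omega>" if "\<omega> \<in> space M" for \<omega>
        by (rule chain(2)[OF that])
    qed
    also have "\<dots> = (\<Prod>j=Suc i..k. ?U j) * expectation ?Y"
      by simp
    also have "\<dots> \<le> (\<Prod>j=Suc i..k. ?U j) * (\<sigma>\<^sup>2 * (real (s k) - real r) / (1 - ?\<delta>))"
      by (rule mult_left_mono[OF Y_upper U_nonneg])
    finally have upper: "expectation ?X
        \<le> \<sigma>\<^sup>2 * (real (s k) - real r) * (\<Prod>j=Suc i..k. ?U j) / (1 - ?\<delta>)"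
      by (simp only: reorder)
    have lower: "\<sigma>\<^sup>2 * (real (s k) - real r) * (\<Prod>j=Suc i..k. ?L j) / (1 + ?\<delta>) \<le> expectation ?X"
      if cases: "(\<forall>j \<in> {Suc i..k}. 0 \<le> ?L j) \<or> (\<Prod>j=Suc i..k. ?L j) \<le> 0"
    proof (cases "\<forall>j \<in> {Suc i..k}. 0 \<le> ?L j")
      case True
      have "\<sigma>\<^sup>2 * (real (s k) - real r) * (\<Prod>j=Suc i..k. ?L j) / (1 + ?\<delta>)
          = (\<Prod>j=Suc i..k. ?L j) * (\<sigma>\<^sup>2 * (real (s k) - real r) / (1 + ?\<delta>))"
        by (simp only: reorder)
      also have "\<dots> \<le> (\<Prod>j=Suc i..k. ?L j) * expectation ?Y"
        by (intro mult_left_mono[OF Y_lower] prod_nonneg) (use True in blast)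
      also have "\<dots> = expectation (\<lambda>\<omega>. (\<Prod>j=Suc i..k. ?L j) * ?Y \<omega>)"
        by simp
      also have "\<dots> \<le> expectation ?X"
      proof (rule integral_mono[OF _ int_X])
        show "integrable M (\<lambda>\<omega>. (\<Prod>j=Suc i..k. ?L j) * ?Y \<omega>)"
          using int_Y by (rule integrable_mult_right)
        show "(\<Prod>j=Suc i..k. ?L j) * ?Y \<omega> \<le> ?X \<omega>" if \<omega>: "\<omega> \<in> space M" for \<omega>
          using chain(3)[OF \<omega>] True by blast
      qed
      finally show ?thesis .
    next
      case False
      then have "(\<Prod>j=Suc i..k. ?L j) \<le> 0" using cases by blast
      then have "\<sigma>\<^sup>2 * (real (s k) - real r) * (\<Prod>j=Suc i..k. ?L j) / (1 + ?\<delta>) \<le> 0"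
        using dim \<delta> by (intro divide_nonpos_pos mult_nonneg_nonpos) auto
      also have "0 \<le> expectation ?X"
        by (intro integral_nonneg_AE AE_I2 sq_norm2_nonneg)
      finally show ?thesis .
    qed
    show ?thesis
      using int_X lower upper by (simp only: Suc_eq_plus1) blast
  qed
qed

end
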